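(* Let $\beta\in(1,2]$, let $u\in H^2(\mathbb{R})\setminus\{0\}$ be real-valued, and let $k$ be an even positive integer. Then $$\int_{\mathbb{R}}u^{k+1}D^\beta u\,dx>0 .$$
   Context: $D^\beta f=(|\xi|^\beta\widehat f)^\vee$ is the fractional derivative of order $\beta$, with $\widehat f(\xi)=\int_{\mathbb{R}} e^{-ix\xi}f(x)\,dx$. *)

theory Defs
  imports "HOL-Analysis.Analysis" "HOL-Library.Complex_Order"
begin

text \<open>
  Elements of \<open>L\<^sup>2(\<real>)\<close> are represented by Borel functions, with almost-everywhere equality
  in place of equality.
\<close>

definition L2 :: "(real \<Rightarrow> complex) set" where
  "L2 = {f \<in> borel_measurable lborel. integrable lborel (\<lambda>x. (cmod (f x))\<^sup>2)}"

text \<open>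
  The limit in \<open>L\<^sup>2\<close> as \<open>R\<close> tends to infinity.  It is unique up to null sets; if there is no limit,
  the value is arbitrary.
\<close>

definition L2_lim :: "(real \<Rightarrow> real \<Rightarrow> complex) \<Rightarrow> real \<Rightarrow> complex" where
  "L2_lim F = (SOME g. g \<in> L2 \<and>
     ((\<lambda>R. \<integral>\<^sup>+ x. ennreal ((cmod (F R x - g x))\<^sup>2) \<partial>lborel) \<longlongrightarrow> 0) at_top)"

text \<open>
  For \<open>f \<in> L\<^sup>2\<close> the integral \<open>\<integral> e\<^sup>-\<^sup>i\<^sup>x\<^sup>\<xi> f(x) dx\<close> need not converge absolutely, so the transform is
  Plancherel's: the \<open>L\<^sup>2\<close>-limit of the integrals over \<open>[-R, R]\<close>.  For \<open>f \<in> L\<^sup>1 \<inter> L\<^sup>2\<close> this agrees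
  almost everywhere with the integral over \<open>\<real>\<close>.
\<close>

definition fourier :: "(real \<Rightarrow> complex) \<Rightarrow> real \<Rightarrow> complex" where
  "fourier f = L2_lim (\<lambda>R \<xi>. LINT x:{-R..R}|lborel. exp (- (\<i> * of_real (x * \<xi>))) * f x)"

definition inv_fourier :: "(real \<Rightarrow> complex) \<Rightarrow> real \<Rightarrow> complex" where
  "inv_fourier g = L2_lim (\<lambda>R x.
     1 / (2 * of_real pi) * (LINT \<xi>:{-R..R}|lborel. exp (\<i> * of_real (x * \<xi>)) * g \<xi>))"

text \<open>
  The space \<open>H\<^sup>s(\<real>)\<close> for \<open>s \<ge> 0\<close>; for \<open>s < 0\<close> its elements would be distributions.
\<close>

definition sobolev :: "real \<Rightarrow> (real \<Rightarrow> complex) set" where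
  "sobolev s = {f \<in> L2. (\<lambda>\<xi>. of_real ((1 + \<xi>\<^sup>2) powr (s / 2)) * fourier f \<xi>) \<in> L2}"

definition frac_deriv :: "real \<Rightarrow> (real \<Rightarrow> complex) \<Rightarrow> real \<Rightarrow> complex" where
  "frac_deriv \<beta> f = inv_fourier (\<lambda>\<xi>. of_real (\<bar>\<xi>\<bar> powr \<beta>) * fourier f \<xi>)"

end

theory Submission
  imports Defs "HOL-Probability.Probability"
begin

text \<open>
  Put \<open>f = u\<^sup>k\<^sup>+\<^sup>1\<close>.  By Parseval, \<open>2\<pi> \<integral> f D\<^sup>\<beta>u\<close> is the integral of \<open>|\<xi>|\<^sup>\<beta>\<close> against the product of
  \<open>fourier u \<xi>\<close> and \<open>fourier f (-\<xi>)\<close>, whereas \<open>1 - cos (\<xi> y)\<close> against the same product gives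
  \<open>\<pi> Q(y)\<close> with \<open>Q(y) = \<integral> (f(x+y) - f(x)) (u(x+y) - u(x)) dx\<close>.  Since \<open>k\<close> is even, \<open>f\<close> is a strictly
  increasing function of \<open>u\<close>, so \<open>Q(y) > 0\<close> for \<open>y > 0\<close>.  For \<open>\<beta> < 2\<close> the symbol \<open>|\<xi>|\<^sup>\<beta>\<close> is a positive
  multiple of \<open>\<integral> (1 - cos (\<xi> y)) y\<^sup>-\<^sup>1\<^sup>-\<^sup>\<beta> dy\<close> over \<open>y > 0\<close>.  For \<open>\<beta> = 2\<close> it is the limit of
  \<open>2 n\<^sup>2 (1 - cos (\<xi> / n))\<close>, and \<open>n\<^sup>2 Q(1/n)\<close> stays away from \<open>0\<close>: with \<open>v = u\<^sup>k\<^sup>/\<^sup>2\<^sup>+\<^sup>1\<close>, \<open>Q(y)\<close> dominates a multiple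
  of \<open>P(y) = \<integral> (v(x+y) - v(x))\<^sup>2 dx\<close>, and \<open>P(1) \<le> n\<^sup>2 P(1/n)\<close>.
\<close>

section \<open>Continuity of translation in \<open>L\<^sup>1\<close>\<close>

text \<open>The whole symbol \<open>\<bar>\<xi>\<bar> powr \<beta>\<close> stays on the transform of
  \<open>u\<close>, where H^2 regularity absorbs it, while u^(k+1) enters through L1 and L2
  membership and an ordinary Fourier integral. The values of \<open>fourier\<close> and
  \<open>inv_fourier\<close> are choices among almost everywhere equal L2 limits, so they are
  reached through integrals against L2 functions; even the boundedness of \<open>u\<close> comes
  from duality.

  The exponent k/2 + 1 is read off the chain rule: (u^(k+1))' u' and ((u^(k/2+1))')^2 are both
  constant multiples of u^k (u')^2, and the comparison of Q with P is the finite-difference form of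
  this. The endpoint needs it because for \<beta> = 2 and nonzero \<xi> the integral of (1 - cos
  (\<xi> y)) y^(-1-\<beta>) diverges at y = 0, and a limit of positive numbers may be 0. The square
  root of P(y) is the L2 norm of an increment, hence subadditive in y, which gives the uniform
  bound.

  In the order on complex numbers, \<open>> 0\<close> includes a vanishing imaginary part, so
  realness is proved along with positivity.\<close>

lemma integral_norm_shift_diff_le:
  fixes f :: "real \<Rightarrow> 'a::{banach, second_countable_topology}"
  assumes "integrable lborel f"
  shows "(LINT x|lborel. norm (f (x + a) - f x)) \<le> 2 * (LINT x|lborel. norm (f x))"
    and "integrable lborel (\<lambda>x. f (x + a))"
proof -
  show i: "integrable lborel (\<lambda>x. f (x + a))"
    using lborel_integrable_real_affine[OF assms, of 1 a] by (simp add: add.commute)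
  have "(LINT x|lborel. norm (f (x + a) - f x)) \<le> (LINT x|lborel. norm (f (x + a)) + norm (f x))"
    using assms i by (intro integral_mono) (auto intro: norm_triangle_ineq4)
  also have "\<dots> = (LINT x|lborel. norm (f (x + a))) + (LINT x|lborel. norm (f x))"
    using assms i by (intro Bochner_Integration.integral_add) auto
  also have "(LINT x|lborel. norm (f (x + a))) = (LINT x|lborel. norm (f x))"
    using lborel_integral_real_affine[of 1 "\<lambda>x. norm (f x)" a] by (simp add: add.commute)
  finally show "(LINT x|lborel. norm (f (x + a) - f x)) \<le> 2 * (LINT x|lborel. norm (f x))" by simp
qed

text \<open>Pointwise convergence can fail on the boundary of \<open>A\<close>, but it holds for the
  one-sided part \<open>m n\<close>: points of \<open>A\<close> eventually stay in \<open>A\<close>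
  by openness, and outside \<open>A\<close> this part is 0. Since \<open>A\<close> and its translate
  have equal measure, the two one-sided parts have equal integrals, so the full difference
  integrates to twice \<open>m n\<close>.\<close>

lemma indicator_shift_L1:
  fixes A :: "real set" and z :: "nat \<Rightarrow> real"
  assumes A: "open A" "emeasure lborel A < \<infinity>" and z: "z \<longlonglongrightarrow> 0"
  shows "(\<lambda>n. LINT x|lborel. \<bar>indicator A (x + z n) - indicator A x :: real\<bar>) \<longlonglongrightarrow> 0"
proof -
  have [measurable]: "A \<in> sets borel" using A by auto
  have iA: "integrable lborel (indicator A :: real \<Rightarrow> real)"
    using A by (simp add: less_top)
  note iAs = integral_norm_shift_diff_le(2)[OF iA]
  define m where "m n x = max (indicator A x - indicator A (x + z n)) (0::real)" for n x
  have im: "integrable lborel (m n)" for n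
  proof (rule Bochner_Integration.integrable_bound[OF iA])
    show "m n \<in> borel_measurable lborel" unfolding m_def by measurable
  qed (auto simp: m_def indicator_def)
  have "(\<lambda>n. LINT x|lborel. m n x) \<longlonglongrightarrow> (LINT x::real|lborel. 0)"
  proof (rule Bochner_Integration.integral_dominated_convergence[OF _ _ iA])
    show "AE x in lborel. (\<lambda>n. m n x) \<longlonglongrightarrow> 0"
    proof (rule AE_I2)
      fix x
      show "(\<lambda>n. m n x) \<longlonglongrightarrow> 0"
      proof (cases "x \<in> A")
        case True
        have "(\<lambda>n. x + z n) \<longlonglongrightarrow> x" using tendsto_add[OF tendsto_const z, of x] by simp
        then have "\<forall>\<^sub>F n in sequentially. x + z n \<in> A"
          using A True by (rule_tac topological_tendstoD) auto
        then have "\<forall>\<^sub>F n in sequentially. m n x = 0"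
          by eventually_elim (auto simp: m_def)
        then show ?thesis by (simp add: tendsto_eventually)
      qed (simp add: m_def)
    qed
  qed (auto simp: m_def indicator_def)
  moreover have "(LINT x|lborel. \<bar>indicator A (x + z n) - indicator A x :: real\<bar>) = 2 * (LINT x|lborel. m n x)" for n
  proof -
    have "(LINT x|lborel. \<bar>indicator A (x + z n) - indicator A x :: real\<bar>)
        = (LINT x|lborel. 2 * m n x - (indicator A x - indicator A (x + z n)))"
      by (rule Bochner_Integration.integral_cong) (auto simp: m_def indicator_def)
    also have "\<dots> = 2 * (LINT x|lborel. m n x) - ((LINT x|lborel. indicator A x) - (LINT x|lborel. indicator A (x + z n)))"
      using im iA iAs by simp
    also have "(LINT x|lborel. indicator A (x + z n) :: real) = (LINT x|lborel. indicator A x)"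
      using lborel_integral_real_affine[of 1 "indicator A :: real \<Rightarrow> real" "z n"] by (simp add: add.commute)
    finally show ?thesis by simp
  qed
  ultimately show ?thesis
    using tendsto_mult_left[of "\<lambda>n. LINT x|lborel. m n x" 0 sequentially 2] by simp
qed

text \<open>The density argument: shifting moves \<open>f - g\<close> by at most twice its L1 norm,
  hence by less than e/2, and \<open>g\<close> eventually contributes less than e/4.\<close>

lemma shift_L1_approx:
  fixes f :: "real \<Rightarrow> 'a::{banach, second_countable_topology}" and z :: "nat \<Rightarrow> real"
  assumes f: "integrable lborel f"
    and approx: "\<And>e. e > 0 \<Longrightarrow> \<exists>g. integrable lborel g \<and> (LINT x|lborel. norm (f x - g x)) < e
      \<and> (\<lambda>n. LINT x|lborel. norm (g (x + z n) - g x)) \<longlonglongrightarrow> 0"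
  shows "(\<lambda>n. LINT x|lborel. norm (f (x + z n) - f x)) \<longlonglongrightarrow> 0"
proof (rule LIMSEQ_I)
  fix e :: real assume "e > 0"
  then obtain g where g: "integrable lborel g" "(LINT x|lborel. norm (f x - g x)) < e / 4"
    "(\<lambda>n. LINT x|lborel. norm (g (x + z n) - g x)) \<longlonglongrightarrow> 0" using approx[of "e/4"] by auto
  from LIMSEQ_D[OF g(3), of "e/4"] \<open>e > 0\<close> obtain N where
    N: "\<And>n. n \<ge> N \<Longrightarrow> \<bar>LINT x|lborel. norm (g (x + z n) - g x)\<bar> < e / 4" by (auto simp: divide_pos_pos)
  show "\<exists>no. \<forall>n\<ge>no. norm ((LINT x|lborel. norm (f (x + z n) - f x)) - 0) < e"
  proof (intro exI allI impI)
    fix n assume "n \<ge> N"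
    let ?d = "\<lambda>x. f x - g x"
    have id: "integrable lborel ?d" using f g by auto
    note sh = integral_norm_shift_diff_le(2)
    have "(LINT x|lborel. norm (f (x + z n) - f x))
      \<le> (LINT x|lborel. norm (?d (x + z n) - ?d x) + norm (g (x + z n) - g x))"
    proof (rule integral_mono)
      fix x show "norm (f (x + z n) - f x) \<le> norm (?d (x + z n) - ?d x) + norm (g (x + z n) - g x)"
        using norm_triangle_ineq[of "?d (x + z n) - ?d x" "g (x + z n) - g x"] by (simp add: algebra_simps)
    qed (use f g sh[OF f] sh[OF g(1)] in \<open>auto\<close>)
    also have "\<dots> = (LINT x|lborel. norm (?d (x + z n) - ?d x)) + (LINT x|lborel. norm (g (x + z n) - g x))"
      by (rule Bochner_Integration.integral_add) (use f g sh[OF f] sh[OF g(1)] in \<open>auto\<close>)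
    also have "\<dots> \<le> 2 * (LINT x|lborel. norm (?d x)) + e / 4"
      using integral_norm_shift_diff_le(1)[OF id, of "z n"] N[OF \<open>n \<ge> N\<close>] by linarith
    also have "\<dots> < e" using g(2) \<open>e > 0\<close> by linarith
    finally show "norm ((LINT x|lborel. norm (f (x + z n) - f x)) - 0) < e" by simp
  qed
qed

lemma translation_L1:
  fixes f :: "real \<Rightarrow> 'a::{banach, second_countable_topology}" and z :: "nat \<Rightarrow> real"
  assumes "integrable lborel f" and z: "z \<longlonglongrightarrow> 0"
  shows "(\<lambda>n. LINT x|lborel. norm (f (x + z n) - f x)) \<longlonglongrightarrow> 0"
  using assms(1)
proof (induction f rule: integrable_induct)
  case (base A c)
  have A: "A \<in> sets borel" "emeasure lborel A < \<infinity>" using base by auto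
  have iA: "integrable lborel (indicator A :: real \<Rightarrow> real)"
    using A by (simp add: less_top)
  show ?case
  proof (rule shift_L1_approx)
    show "integrable lborel (\<lambda>x. indicat_real A x *\<^sub>R c)" using iA by auto
    fix e :: real assume "e > 0"
    \<comment> \<open>The added 1 covers \<open>c = 0\<close> and keeps \<open>d * norm c\<close>
      strictly below \<open>e\<close>. The set \<open>U\<close> below comes from outer regularity,
      which reduces Borel sets to open ones.\<close>
    define d where "d = e / (norm c + 1)"
    have "d > 0" unfolding d_def using \<open>e > 0\<close> by (simp add: add_nonneg_pos)
    obtain U where U: "open U" "A \<subseteq> U" "U - A \<in> lmeasurable" "emeasure lebesgue (U - A) < ennreal d"
      using sets_lebesgue_outer_open[of A d] A \<open>d > 0\<close> by (metis sets_completionI_sets sets_lborel)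
    have UB[measurable]: "U \<in> sets borel" "A \<in> sets borel" using U A by auto
    have UA: "emeasure lborel (U - A) < ennreal d" using U by simp
    have "emeasure lborel U \<le> emeasure lborel A + emeasure lborel (U - A)"
      by (metis Diff_partition U(2) UB emeasure_subadditive sets.Diff sets_lborel)
    also have "\<dots> < \<infinity>"
      using A(2) order.strict_trans[OF UA ennreal_less_top] by simp
    finally have U2: "emeasure lborel U < \<infinity>" .
    have iU: "integrable lborel (indicator U :: real \<Rightarrow> real)" using U2 by (simp add: less_top)
    show "\<exists>g. integrable lborel g \<and> (LINT x|lborel. norm (indicat_real A x *\<^sub>R c - g x)) < e
      \<and> (\<lambda>n. LINT x|lborel. norm (g (x + z n) - g x)) \<longlonglongrightarrow> 0"
    proof (intro exI[of _ "\<lambda>x. indicat_real U x *\<^sub>R c"] conjI)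
      show "integrable lborel (\<lambda>x. indicat_real U x *\<^sub>R c)" using iU by auto
      have "(LINT x|lborel. norm (indicat_real A x *\<^sub>R c - indicat_real U x *\<^sub>R c)) = (LINT x|lborel. indicat_real (U - A) x * norm c)"
        using U(2) by (intro Bochner_Integration.integral_cong) (auto simp: indicator_def)
      also have "\<dots> = measure lborel (U - A) * norm c" by simp
      also have "measure lborel (U - A) \<le> d" using UA \<open>d > 0\<close> unfolding measure_def
        by (metis enn2real_leI less_eq_real_def less_imp_le)
      then have "measure lborel (U - A) * norm c \<le> d * norm c" by (rule mult_right_mono) auto
      also have "d * norm c < e"
        unfolding d_def using \<open>e > 0\<close> norm_ge_zero[of c] by (simp add: pos_divide_less_eq add_nonneg_pos)
      finally show "(LINT x|lborel. norm (indicat_real A x *\<^sub>R c - indicat_real U x *\<^sub>R c)) < e" .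
      have "(\<lambda>n. LINT x|lborel. norm (indicat_real U (x + z n) *\<^sub>R c - indicat_real U x *\<^sub>R c))
        = (\<lambda>n. (LINT x|lborel. \<bar>indicat_real U (x + z n) - indicat_real U x\<bar>) * norm c)"
        by (simp add: scaleR_diff_left[symmetric])
      then show "(\<lambda>n. LINT x|lborel. norm (indicat_real U (x + z n) *\<^sub>R c - indicat_real U x *\<^sub>R c)) \<longlonglongrightarrow> 0"
        using tendsto_mult_right[OF indicator_shift_L1[OF U(1) U2 z], of "norm c"] by simp
    qed
  qed
next
  case (add f g)
  note sh = integral_norm_shift_diff_le(2)
  show ?case
  proof (rule tendsto_sandwich[OF _ _ tendsto_const])
    show "\<forall>\<^sub>F n in sequentially. (LINT x|lborel. norm (f (x + z n) + g (x + z n) - (f x + g x)))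
      \<le> (LINT x|lborel. norm (f (x + z n) - f x)) + (LINT x|lborel. norm (g (x + z n) - g x))"
    proof (rule always_eventually, rule allI)
      fix n
      have "(LINT x|lborel. norm (f (x + z n) + g (x + z n) - (f x + g x)))
        \<le> (LINT x|lborel. norm (f (x + z n) - f x) + norm (g (x + z n) - g x))"
        by (rule integral_mono) (use add sh[OF add(1)] sh[OF add(2)] in \<open>auto intro: norm_diff_triangle_ineq\<close>)
      also have "\<dots> = (LINT x|lborel. norm (f (x + z n) - f x)) + (LINT x|lborel. norm (g (x + z n) - g x))"
        by (rule Bochner_Integration.integral_add) (use add sh[OF add(1)] sh[OF add(2)] in \<open>auto\<close>)
      finally show "(LINT x|lborel. norm (f (x + z n) + g (x + z n) - (f x + g x))) \<le> \<dots>" .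
    qed
    show "(\<lambda>n. (LINT x|lborel. norm (f (x + z n) - f x)) + (LINT x|lborel. norm (g (x + z n) - g x))) \<longlonglongrightarrow> 0"
      using tendsto_add[OF add.IH] by simp
  qed auto
next
  case (lim f s)
  show ?case
  proof (rule shift_L1_approx)
    fix e :: real assume "e > 0"
    have "(\<lambda>i. LINT x|lborel. norm (f x - s i x)) \<longlonglongrightarrow> (LINT x::real|lborel. 0)"
    proof (rule Bochner_Integration.integral_dominated_convergence)
      \<comment> \<open>The approximants satisfy \<open>norm (s i x) \<le> 2 * norm (f x)\<close>,
        so the difference is at most three times \<open>norm (f x)\<close>.\<close>
      show "integrable lborel (\<lambda>x. 3 * norm (f x))" using lim by auto
      show "AE x in lborel. (\<lambda>i. norm (f x - s i x)) \<longlonglongrightarrow> 0"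
      proof (rule AE_I2)
        fix x show "(\<lambda>i. norm (f x - s i x)) \<longlonglongrightarrow> 0"
          using tendsto_norm[OF tendsto_diff[OF tendsto_const lim.hyps(2)[of x], of "f x"]] by simp
      qed
      show "AE x in lborel. norm (norm (f x - s i x)) \<le> 3 * norm (f x)" for i
      proof (rule AE_I2)
        fix x show "norm (norm (f x - s i x)) \<le> 3 * norm (f x)"
          using lim.hyps(3)[of x i] norm_triangle_ineq4[of "f x" "s i x"] by simp
      qed
    qed (use lim in auto)
    then have "\<forall>\<^sub>F i in sequentially. (LINT x|lborel. norm (f x - s i x)) < e"
      using \<open>e > 0\<close> by (auto dest: order_tendstoD(2))
    then obtain i where "(LINT x|lborel. norm (f x - s i x)) < e" by (auto simp: eventually_sequentially)
    then show "\<exists>g. integrable lborel g \<and> (LINT x|lborel. norm (f x - g x)) < e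
      \<and> (\<lambda>n. LINT x|lborel. norm (g (x + z n) - g x)) \<longlonglongrightarrow> 0"
      using lim by (intro exI[of _ "s i"]) auto
  qed (use lim in auto)
qed

section \<open>Fourier integrals\<close>

text \<open>Defined pointwise by a single integral, in contrast to \<open>fourier\<close>, which is
  the L2 limit of \<open>FT\<close> over truncations.\<close>

definition FT :: "(real \<Rightarrow> complex) \<Rightarrow> real \<Rightarrow> complex" where
  "FT f \<xi> = (LINT x|lborel. exp (- (\<i> * of_real (x * \<xi>))) * f x)"

lemma norm_exp_minus_i [simp]: "cmod (exp (- (\<i> * of_real r))) = 1"
  using norm_exp_i_times[of "-r"] by simp

lemma integrable_exp_mult:
  assumes "integrable lborel f"
  shows "integrable lborel (\<lambda>x. exp (- (\<i> * of_real (x * \<xi>))) * f x)"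
proof (rule Bochner_Integration.integrable_bound[OF assms])
  have [measurable]: "f \<in> borel_measurable lborel" using assms by auto
  show "(\<lambda>x. exp (- (\<i> * of_real (x * \<xi>))) * f x) \<in> borel_measurable lborel" by measurable
qed (simp add: norm_mult)

lemma norm_FT_le:
  assumes "integrable lborel f"
  shows "cmod (FT f \<xi>) \<le> (LINT x|lborel. cmod (f x))"
  unfolding FT_def
  using integral_norm_bound[of lborel "\<lambda>x. exp (- (\<i> * of_real (x * \<xi>))) * f x"]
  by (simp add: norm_mult)

lemma borel_measurable_FT [measurable]:
  assumes [measurable]: "f \<in> borel_measurable lborel"
  shows "FT f \<in> borel_measurable lborel"
  unfolding FT_def by measurable

lemma FT_cnj: "FT (\<lambda>x. cnj (f x)) (- \<xi>) = cnj (FT f \<xi>)"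
  unfolding FT_def Bochner_Integration.integral_cnj[symmetric]
  by (simp add: exp_cnj del: Bochner_Integration.integral_cnj)

lemma FT_shift: "FT (\<lambda>x. f (x - y)) \<xi> = exp (- (\<i> * of_real (y * \<xi>))) * FT f \<xi>"
proof -
  have "FT (\<lambda>x. f (x - y)) \<xi> = (LINT x|lborel. exp (- (\<i> * of_real (y * \<xi>))) * (exp (- (\<i> * of_real (x * \<xi>))) * f x))"
    unfolding FT_def by (subst lborel_integral_real_affine[where c=1 and t=y])
      (auto simp: exp_add[symmetric] algebra_simps intro!: Bochner_Integration.integral_cong)
  then show ?thesis unfolding FT_def by simp
qed

section \<open>Gaussian regularisation of Parseval's identity\<close>

lemma gaussian_FT:
  assumes "\<epsilon> > 0"
  shows "FT (\<lambda>\<xi>. of_real (exp (- (\<epsilon> * \<xi>)\<^sup>2 / 2))) t = of_real (2 * pi / \<epsilon> * std_normal_density (t / \<epsilon>))"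
proof -
  \<comment> \<open>The characteristic function of the standard normal law at
    \<open>- (t / \<epsilon>)\<close> is again a Gaussian, and substituting
    \<open>s = \<epsilon> * \<xi>\<close> turns it into the transform wanted. The result is written
    as 2 pi times a rescaled normal density, an approximate identity as \<epsilon> tends to
    0.\<close>
  have "char std_normal_distribution (- (t / \<epsilon>)) = (LINT s|lborel. std_normal_density s *\<^sub>R iexp (- (t / \<epsilon>) * s))"
    unfolding char_def by (subst integral_density) (auto simp: normal_density_nonneg)
  also have "\<dots> = (LINT s|lborel. of_real (1 / sqrt (2 * pi)) * (of_real (exp (- s\<^sup>2 / 2)) * exp (- (\<i> * of_real (t / \<epsilon> * s)))))"
    by (intro Bochner_Integration.integral_cong) (auto simp: std_normal_density_def scaleR_conv_of_real)
  also have "\<dots> = of_real (1 / sqrt (2 * pi)) * (LINT s|lborel. of_real (exp (- s\<^sup>2 / 2)) * exp (- (\<i> * of_real (t / \<epsilon> * s))))"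
    by simp
  also have "(LINT s|lborel. of_real (exp (- s\<^sup>2 / 2)) * exp (- (\<i> * of_real (t / \<epsilon> * s))))
     = \<epsilon> *\<^sub>R FT (\<lambda>\<xi>. of_real (exp (- (\<epsilon> * \<xi>)\<^sup>2 / 2))) t"
    unfolding FT_def
    by (subst lborel_integral_real_affine[where c=\<epsilon> and t=0])
      (use assms in \<open>auto simp: ac_simps intro!: Bochner_Integration.integral_cong\<close>)
  finally have "of_real (exp (- (t / \<epsilon>)\<^sup>2 / 2)) = of_real (1 / sqrt (2 * pi)) * (\<epsilon> *\<^sub>R FT (\<lambda>\<xi>. of_real (exp (- (\<epsilon> * \<xi>)\<^sup>2 / 2))) t)"
    by (simp add: char_std_normal_distribution)
  then have "FT (\<lambda>\<xi>. of_real (exp (- (\<epsilon> * \<xi>)\<^sup>2 / 2))) t = of_real (sqrt (2 * pi) / \<epsilon> * exp (- (t / \<epsilon>)\<^sup>2 / 2))"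
    using assms by (simp add: scaleR_conv_of_real field_simps)
  also have "sqrt (2 * pi) / \<epsilon> * exp (- (t / \<epsilon>)\<^sup>2 / 2) = 2 * pi / \<epsilon> * std_normal_density (t / \<epsilon>)"
    unfolding std_normal_density_def using assms real_div_sqrt[of "2 * pi"] by (simp add: field_simps)
  finally show ?thesis .
qed

lemma integrable_gaussian:
  assumes "\<epsilon> > 0"
  shows "integrable lborel (\<lambda>\<xi>::real. exp (- (\<epsilon> * \<xi>)\<^sup>2 / 2))"
proof -
  have "integrable lborel (\<lambda>s. sqrt (2 * pi) * std_normal_density s)" by auto
  then have "integrable lborel (\<lambda>s::real. exp (- s\<^sup>2 / 2))" by (simp add: std_normal_density_def)
  from lborel_integrable_real_affine[OF this, of \<epsilon> 0] assms show ?thesis by simp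
qed

text \<open>Fubini's hypothesis for exchanges against a bounded kernel: a pure exponential with
  \<open>B = 1\<close>, or \<open>FT f\<close> times an exponential, bounded by the L1 norm of
  \<open>f\<close>.\<close>

lemma integrable_kernel:
  fixes f g :: "real \<Rightarrow> complex" and K :: "real \<Rightarrow> real \<Rightarrow> complex"
  assumes f: "integrable lborel f" and g: "integrable lborel g"
    and K: "(\<lambda>(x, y). K x y) \<in> borel_measurable (lborel \<Otimes>\<^sub>M lborel)" and B: "\<And>x y. cmod (K x y) \<le> B"
  shows "integrable (lborel \<Otimes>\<^sub>M lborel) (\<lambda>(x, y). K x y * f x * g y)"
proof -
  have [measurable]: "f \<in> borel_measurable borel" "g \<in> borel_measurable borel" using f g by auto
  have 1: "integrable (lborel \<Otimes>\<^sub>M lborel) (\<lambda>(x, y). f x * g y)"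
  proof (rule lborel_pair.Fubini_integrable)
    have "(\<lambda>x. LINT y|lborel. norm (case (x, y) of (x, y) \<Rightarrow> f x * g y)) = (\<lambda>x. norm (f x) * (LINT y|lborel. norm (g y)))"
      by (simp add: norm_mult)
    then show "integrable lborel (\<lambda>x. LINT y|lborel. norm (case (x, y) of (x, y) \<Rightarrow> f x * g y))" using f by simp
  qed (use f g in auto)
  have 2: "integrable (lborel \<Otimes>\<^sub>M lborel) (\<lambda>p. B * norm ((\<lambda>(x, y). f x * g y) p))"
    using 1 by (intro integrable_mult_right) auto
  show ?thesis
  proof (rule Bochner_Integration.integrable_bound[OF 2])
    have "(\<lambda>p. (\<lambda>(x, y). K x y) p * f (fst p) * g (snd p)) \<in> borel_measurable (lborel \<Otimes>\<^sub>M lborel)"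
      using K by measurable
    then show "(\<lambda>(x, y). K x y * f x * g y) \<in> borel_measurable (lborel \<Otimes>\<^sub>M lborel)"
      by (simp add: case_prod_beta)
    show "AE p in lborel \<Otimes>\<^sub>M lborel. norm (case p of (x, y) \<Rightarrow> K x y * f x * g y)
       \<le> norm (B * norm (case p of (x, y) \<Rightarrow> f x * g y))"
    proof (rule AE_I2, unfold split_paired_all)
      fix x y
      show "norm (case (x, y) of (x, y) \<Rightarrow> K x y * f x * g y) \<le> norm (B * norm (case (x, y) of (x, y) \<Rightarrow> f x * g y))"
        using mult_right_mono[OF order_trans[OF B abs_ge_self], of "cmod (f x) * cmod (g y)" x y]
        by (simp add: mult.assoc norm_mult abs_mult)
    qed
  qed
qed

text \<open>Two applications of Fubini carry the transform from \<open>f\<close> and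
  \<open>g\<close> over to the weight \<open>w\<close>, which can then be chosen with an explicit
  transform.\<close>

lemma FT_mult_formula:
  fixes f g w :: "real \<Rightarrow> complex"
  assumes f: "integrable lborel f" and g: "integrable lborel g" and w: "integrable lborel w"
  shows "(LINT \<xi>|lborel. FT f \<xi> * FT g (- \<xi>) * w \<xi>) = (LINT y|lborel. g y * (LINT x|lborel. f x * FT w (x - y)))"
proof -
  have [measurable]: "f \<in> borel_measurable borel" "g \<in> borel_measurable borel" "w \<in> borel_measurable borel"
    using f g w by auto
  have mFT [measurable]: "FT f \<in> borel_measurable borel" using borel_measurable_FT[of f] by simp
  have "(LINT \<xi>|lborel. FT f \<xi> * FT g (- \<xi>) * w \<xi>)
     = (LINT \<xi>|lborel. (LINT y|lborel. (FT f \<xi> * exp (\<i> * of_real (y * \<xi>))) * g y * w \<xi>))"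
  proof (rule Bochner_Integration.integral_cong[OF refl])
    fix \<xi>
    have "(LINT y|lborel. (FT f \<xi> * exp (\<i> * of_real (y * \<xi>))) * g y * w \<xi>)
      = (LINT y|lborel. (FT f \<xi> * w \<xi>) * (exp (- (\<i> * of_real (y * - \<xi>))) * g y))"
      by (intro Bochner_Integration.integral_cong) auto
    also have "\<dots> = FT f \<xi> * FT g (- \<xi>) * w \<xi>" unfolding FT_def[of g] by simp
    finally show "FT f \<xi> * FT g (- \<xi>) * w \<xi> = (LINT y|lborel. (FT f \<xi> * exp (\<i> * of_real (y * \<xi>))) * g y * w \<xi>)" ..
  qed
  also have "\<dots> = (LINT y|lborel. (LINT \<xi>|lborel. (FT f \<xi> * exp (\<i> * of_real (y * \<xi>))) * g y * w \<xi>))"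
    by (rule lborel_pair.Fubini_integral, rule integrable_kernel[OF g w, where B="LINT x|lborel. cmod (f x)"])
      (use norm_FT_le[OF f] in \<open>auto simp: norm_mult\<close>)
  also have "\<dots> = (LINT y|lborel. g y * (LINT x|lborel. f x * FT w (x - y)))"
  proof (rule Bochner_Integration.integral_cong[OF refl])
    fix y
    have "(LINT \<xi>|lborel. FT f \<xi> * exp (\<i> * of_real (y * \<xi>)) * w \<xi>)
       = (LINT \<xi>|lborel. (LINT x|lborel. exp (- (\<i> * of_real ((x - y) * \<xi>))) * f x * w \<xi>))"
    proof (rule Bochner_Integration.integral_cong[OF refl])
      fix \<xi>
      have "(LINT x|lborel. exp (- (\<i> * of_real ((x - y) * \<xi>))) * f x * w \<xi>)
        = (LINT x|lborel. (exp (\<i> * of_real (y * \<xi>)) * w \<xi>) * (exp (- (\<i> * of_real (x * \<xi>))) * f x))"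
        by (intro Bochner_Integration.integral_cong) (auto simp: algebra_simps exp_add[symmetric] exp_diff exp_minus divide_inverse)
      also have "\<dots> = FT f \<xi> * exp (\<i> * of_real (y * \<xi>)) * w \<xi>" unfolding FT_def[of f] by simp
      finally show "FT f \<xi> * exp (\<i> * of_real (y * \<xi>)) * w \<xi> = (LINT x|lborel. exp (- (\<i> * of_real ((x - y) * \<xi>))) * f x * w \<xi>)" ..
    qed
    also have "\<dots> = (LINT x|lborel. (LINT \<xi>|lborel. exp (- (\<i> * of_real ((x - y) * \<xi>))) * f x * w \<xi>))"
      by (rule lborel_pair.Fubini_integral, rule integrable_kernel[OF f w, where B=1]) auto
    also have "\<dots> = (LINT x|lborel. f x * FT w (x - y))"
    proof (rule Bochner_Integration.integral_cong[OF refl])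
      fix x
      have "(LINT \<xi>|lborel. exp (- (\<i> * of_real ((x - y) * \<xi>))) * f x * w \<xi>)
        = (LINT \<xi>|lborel. f x * (exp (- (\<i> * of_real (\<xi> * (x - y)))) * w \<xi>))"
        by (intro Bochner_Integration.integral_cong) (auto simp: ac_simps)
      then show "(LINT \<xi>|lborel. exp (- (\<i> * of_real ((x - y) * \<xi>))) * f x * w \<xi>) = f x * FT w (x - y)"
        unfolding FT_def by simp
    qed
    finally have "(LINT \<xi>|lborel. FT f \<xi> * exp (\<i> * of_real (y * \<xi>)) * w \<xi>) = (LINT x|lborel. f x * FT w (x - y))" .
    moreover have "(LINT \<xi>|lborel. (FT f \<xi> * exp (\<i> * of_real (y * \<xi>))) * g y * w \<xi>)
       = (LINT \<xi>|lborel. g y * ((FT f \<xi> * exp (\<i> * of_real (y * \<xi>))) * w \<xi>))"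
      by (intro Bochner_Integration.integral_cong) (auto simp: ac_simps)
    ultimately show "(LINT \<xi>|lborel. (FT f \<xi> * exp (\<i> * of_real (y * \<xi>))) * g y * w \<xi>) = g y * (LINT x|lborel. f x * FT w (x - y))"
      by simp
  qed
  finally show ?thesis .
qed

text \<open>The Gaussian weight makes the frequency integral absolutely convergent when
  \<open>FT f\<close> and \<open>FT g\<close> are merely bounded. After the substitution
  \<open>x = y + \<epsilon> * s\<close> the other side averages the correlation of \<open>f\<close>
  and \<open>g\<close> at lag \<open>\<epsilon> * s\<close> over a standard normal
  \<open>s\<close>.\<close>

lemma smoothed_parseval:
  fixes f g :: "real \<Rightarrow> complex"
  assumes f: "integrable lborel f" and g: "integrable lborel g" and e: "\<epsilon> > 0"
  shows "(LINT \<xi>|lborel. FT f \<xi> * FT g (- \<xi>) * of_real (exp (- (\<epsilon> * \<xi>)\<^sup>2 / 2)))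
    = 2 * pi * (LINT s|lborel. of_real (std_normal_density s) * (LINT y|lborel. f (y + \<epsilon> * s) * g y))"
proof -
  have [measurable]: "f \<in> borel_measurable borel" "g \<in> borel_measurable borel" using f g by auto
  let ?n = "\<lambda>s. complex_of_real (std_normal_density s)"
  have w: "integrable lborel (\<lambda>\<xi>::real. complex_of_real (exp (- (\<epsilon> * \<xi>)\<^sup>2 / 2)))"
    using integrable_gaussian[OF e] by simp
  have "(LINT \<xi>|lborel. FT f \<xi> * FT g (- \<xi>) * of_real (exp (- (\<epsilon> * \<xi>)\<^sup>2 / 2)))
    = (LINT y|lborel. g y * (LINT x|lborel. f x * of_real (2 * pi / \<epsilon> * std_normal_density ((x - y) / \<epsilon>))))"
    unfolding FT_mult_formula[OF f g w] gaussian_FT[OF e] ..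
  also have "\<dots> = (LINT y|lborel. 2 * pi * (LINT s|lborel. f (y + \<epsilon> * s) * ?n s * g y))"
  proof (rule Bochner_Integration.integral_cong[OF refl])
    fix y
    have "(LINT x|lborel. f x * of_real (2 * pi / \<epsilon> * std_normal_density ((x - y) / \<epsilon>)))
       = \<epsilon> *\<^sub>R (LINT s|lborel. (2 * pi / \<epsilon>) * (f (y + \<epsilon> * s) * ?n s))"
      by (subst lborel_integral_real_affine[where c=\<epsilon> and t=y])
         (use e in \<open>auto simp: ac_simps intro!: Bochner_Integration.integral_cong\<close>)
    also have "\<dots> = 2 * pi * (LINT s|lborel. f (y + \<epsilon> * s) * ?n s)"
      using e by (simp add: scaleR_conv_of_real)
    finally show "g y * (LINT x|lborel. f x * of_real (2 * pi / \<epsilon> * std_normal_density ((x - y) / \<epsilon>)))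
      = 2 * pi * (LINT s|lborel. f (y + \<epsilon> * s) * ?n s * g y)" by (simp add: mult.commute)
  qed
  also have "\<dots> = 2 * pi * (LINT y|lborel. (LINT s|lborel. f (y + \<epsilon> * s) * ?n s * g y))"
    by simp
  also have "(LINT y|lborel. (LINT s|lborel. f (y + \<epsilon> * s) * ?n s * g y))
     = (LINT s|lborel. (LINT y|lborel. f (y + \<epsilon> * s) * ?n s * g y))"
  proof (rule lborel_pair.Fubini_integral[symmetric], rule lborel_pair.Fubini_integrable)
    have sh: "integrable lborel (\<lambda>s. norm (f (y + \<epsilon> * s)))" for y
      using lborel_integrable_real_affine[OF f, of \<epsilon> y] e by simp
    \<comment> \<open>Bounding the density by 1 leaves a translate of \<open>f\<close> to be
      integrated in \<open>s\<close>; this costs the L1 norm of \<open>f\<close> divided by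
      \<epsilon>, uniformly in \<open>y\<close>.\<close>
    have le1: "std_normal_density s \<le> 1" for s
    proof -
      have "sqrt (2 * pi) \<ge> 1" using pi_ge_two by simp
      then have "exp (- s\<^sup>2 / 2) \<le> sqrt (2 * pi)" by (rule order_trans[rotated]) simp
      then show ?thesis unfolding std_normal_density_def by (simp add: field_simps)
    qed
    have m1: "integrable lborel (\<lambda>s. f (y + \<epsilon> * s) * ?n s * g y)" for y
    proof (rule Bochner_Integration.integrable_bound)
      show "integrable lborel (\<lambda>s. norm (f (y + \<epsilon> * s)) * norm (g y))" using sh by auto
      show "AE s in lborel. norm (f (y + \<epsilon> * s) * ?n s * g y) \<le> norm (norm (f (y + \<epsilon> * s)) * norm (g y))"
        using le1 by (intro AE_I2) (auto simp: norm_mult normal_density_nonneg intro!: mult_right_mono mult_left_le)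
    qed simp
    show "AE y in lborel. integrable lborel (\<lambda>s. case (y, s) of (y, s) \<Rightarrow> f (y + \<epsilon> * s) * ?n s * g y)"
      using m1 by simp
    show "integrable lborel (\<lambda>y. LINT s|lborel. norm (case (y, s) of (y, s) \<Rightarrow> f (y + \<epsilon> * s) * ?n s * g y))"
    proof (rule Bochner_Integration.integrable_bound)
      show "integrable lborel (\<lambda>y. norm (g y) * ((LINT x|lborel. norm (f x)) / \<epsilon>))" using g by auto
      show "AE y in lborel. norm (LINT s|lborel. norm (case (y, s) of (y, s) \<Rightarrow> f (y + \<epsilon> * s) * ?n s * g y))
        \<le> norm (norm (g y) * ((LINT x|lborel. norm (f x)) / \<epsilon>))"
      proof (rule AE_I2)
        fix y
        have "(LINT s|lborel. norm (f (y + \<epsilon> * s) * ?n s * g y)) \<le> (LINT s|lborel. norm (g y) * norm (f (y + \<epsilon> * s)))"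
        proof (rule integral_mono)
          show "integrable lborel (\<lambda>s. norm (f (y + \<epsilon> * s) * ?n s * g y))"
            using m1 by (rule integrable_norm)
          fix s
          have "norm (f (y + \<epsilon> * s)) * std_normal_density s \<le> norm (f (y + \<epsilon> * s)) * 1"
            by (intro mult_left_mono le1) auto
          from mult_right_mono[OF this, of "norm (g y)"]
          show "norm (f (y + \<epsilon> * s) * ?n s * g y) \<le> norm (g y) * norm (f (y + \<epsilon> * s))"
            by (simp add: norm_mult mult.commute)
        qed (use sh in auto)
        also have "\<dots> = norm (g y) * (LINT s|lborel. norm (f (y + \<epsilon> * s)))" by simp
        also have "(LINT s|lborel. norm (f (y + \<epsilon> * s))) = (LINT x|lborel. norm (f x)) / \<epsilon>"
          using lborel_integral_real_affine[of \<epsilon> "\<lambda>x. norm (f x)" y] e by simp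
        finally show "norm (LINT s|lborel. norm (case (y, s) of (y, s) \<Rightarrow> f (y + \<epsilon> * s) * ?n s * g y))
          \<le> norm (norm (g y) * ((LINT x|lborel. norm (f x)) / \<epsilon>))" using e
          by (simp add: abs_mult)
      qed
    qed measurable
  qed measurable
  also have "\<dots> = (LINT s|lborel. ?n s * (LINT y|lborel. f (y + \<epsilon> * s) * g y))"
  proof (rule Bochner_Integration.integral_cong[OF refl])
    fix s
    have "(LINT y|lborel. f (y + \<epsilon> * s) * ?n s * g y) = (LINT y|lborel. ?n s * (f (y + \<epsilon> * s) * g y))"
      by (intro Bochner_Integration.integral_cong) (auto simp: ac_simps)
    then show "(LINT y|lborel. f (y + \<epsilon> * s) * ?n s * g y) = ?n s * (LINT y|lborel. f (y + \<epsilon> * s) * g y)" by simp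
  qed
  finally show ?thesis .
qed

section \<open>The space \<open>L\<^sup>2\<close>\<close>

text \<open>Taken in \<open>ennreal\<close>, so that it makes sense before membership in
  \<open>L2\<close> is known; it is the quantity whose limit \<open>L2_lim\<close> requires to
  vanish.\<close>

definition sq_norm :: "(real \<Rightarrow> complex) \<Rightarrow> ennreal" where
  "sq_norm f = (\<integral>\<^sup>+ x. ennreal ((cmod (f x))\<^sup>2) \<partial>lborel)"

lemma L2_iff: "f \<in> L2 \<longleftrightarrow> f \<in> borel_measurable borel \<and> sq_norm f < \<infinity>"
  unfolding L2_def sq_norm_def by (auto simp: integrable_iff_bounded)

lemma L2_measurable [measurable_dest]: "f \<in> L2 \<Longrightarrow> f \<in> borel_measurable borel"
  by (simp add: L2_iff)

lemma L2_integrable: "f \<in> L2 \<Longrightarrow> integrable lborel (\<lambda>x. (cmod (f x))\<^sup>2)"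
  by (simp add: L2_def)

lemma sq_norm_eq: "f \<in> L2 \<Longrightarrow> sq_norm f = ennreal (LINT x|lborel. (cmod (f x))\<^sup>2)"
  unfolding sq_norm_def by (rule nn_integral_eq_integral) (auto simp: L2_integrable)

lemma L2_bound:
  assumes "g \<in> L2" "f \<in> borel_measurable borel" "AE x in lborel. cmod (f x) \<le> B * cmod (g x)"
  shows "f \<in> L2"
  unfolding L2_def
proof safe
  show "integrable lborel (\<lambda>x. (cmod (f x))\<^sup>2)"
  proof (rule Bochner_Integration.integrable_bound)
    show "integrable lborel (\<lambda>x. B\<^sup>2 * (cmod (g x))\<^sup>2)" using L2_integrable[OF assms(1)] by simp
    show "AE x in lborel. norm ((cmod (f x))\<^sup>2) \<le> norm (B\<^sup>2 * (cmod (g x))\<^sup>2)"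
      using assms(3)
    proof eventually_elim
      case (elim x)
      from power_mono[OF this, of 2] show ?case by (simp add: power_mult_distrib)
    qed
  qed (use assms in measurable)
qed (use assms in auto)

lemma integrable_L2_mult:
  assumes "f \<in> L2" "g \<in> L2"
  shows "integrable lborel (\<lambda>x. f x * g x)"
proof (rule Bochner_Integration.integrable_bound)
  show "integrable lborel (\<lambda>x. (cmod (f x))\<^sup>2 + (cmod (g x))\<^sup>2)"
    using L2_integrable[OF assms(1)] L2_integrable[OF assms(2)] by simp
  show "AE x in lborel. norm (f x * g x) \<le> norm ((cmod (f x))\<^sup>2 + (cmod (g x))\<^sup>2)"
  proof (rule AE_I2)
    fix x
    show "norm (f x * g x) \<le> norm ((cmod (f x))\<^sup>2 + (cmod (g x))\<^sup>2)"
      using sum_squares_bound[of "cmod (f x)" "cmod (g x)"] mult_nonneg_nonneg[of "cmod (f x)" "cmod (g x)"]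
      unfolding norm_mult by (simp del: mult_nonneg_nonneg)
  qed
qed (use assms in measurable)

lemma Cauchy_Schwarz_sq_norm:
  assumes [measurable]: "f \<in> borel_measurable borel" "g \<in> borel_measurable borel"
  shows "(\<integral>\<^sup>+ x. ennreal (cmod (f x * g x)) \<partial>lborel)\<^sup>2 \<le> sq_norm f * sq_norm g"
  using Cauchy_Schwarz_nn_integral[of "\<lambda>x. ennreal (cmod (f x))" lborel "\<lambda>x. ennreal (cmod (g x))"]
  unfolding sq_norm_def by (simp add: norm_mult ennreal_mult ennreal_power)

lemma sq_norm_minus_commute: "sq_norm (\<lambda>x. f x - g x) = sq_norm (\<lambda>x. g x - f x)"
  unfolding sq_norm_def by (simp add: norm_minus_commute)

text \<open>The factors 2 come from (a + b)^2 \<le> 2 a^2 + 2 b^2. They are harmless, as the bound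
  serves for finiteness and for convergence to 0.\<close>

lemma sq_norm_triangle:
  assumes [measurable]: "f \<in> borel_measurable borel" "g \<in> borel_measurable borel" "h \<in> borel_measurable borel"
  shows "sq_norm (\<lambda>x. f x - h x) \<le> 2 * sq_norm (\<lambda>x. f x - g x) + 2 * sq_norm (\<lambda>x. g x - h x)"
proof -
  have "sq_norm (\<lambda>x. f x - h x) \<le> (\<integral>\<^sup>+ x. 2 * ennreal ((cmod (f x - g x))\<^sup>2) + 2 * ennreal ((cmod (g x - h x))\<^sup>2) \<partial>lborel)"
    unfolding sq_norm_def
  proof (rule nn_integral_mono)
    fix x
    have "cmod (f x - h x) \<le> cmod (f x - g x) + cmod (g x - h x)"
      using norm_triangle_ineq[of "f x - g x" "g x - h x"] by simp
    then have "(cmod (f x - h x))\<^sup>2 \<le> (cmod (f x - g x) + cmod (g x - h x))\<^sup>2" by (intro power_mono) auto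
    also have "\<dots> \<le> 2 * (cmod (f x - g x))\<^sup>2 + 2 * (cmod (g x - h x))\<^sup>2"
      using sum_squares_bound[of "cmod (f x - g x)" "cmod (g x - h x)"] by (simp add: power2_sum)
    finally have "ennreal ((cmod (f x - h x))\<^sup>2) \<le> ennreal (2 * (cmod (f x - g x))\<^sup>2 + 2 * (cmod (g x - h x))\<^sup>2)"
      by (rule ennreal_leI)
    then show "ennreal ((cmod (f x - h x))\<^sup>2) \<le> 2 * ennreal ((cmod (f x - g x))\<^sup>2) + 2 * ennreal ((cmod (g x - h x))\<^sup>2)"
      by (simp add: ennreal_plus ennreal_mult)
  qed
  also have "\<dots> = 2 * sq_norm (\<lambda>x. f x - g x) + 2 * sq_norm (\<lambda>x. g x - h x)"
    unfolding sq_norm_def by (simp add: nn_integral_add nn_integral_cmult)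
  finally show ?thesis .
qed

lemma L2_diff:
  assumes "f \<in> L2" "g \<in> L2"
  shows "(\<lambda>x. f x - g x) \<in> L2"
proof -
  have "sq_norm (\<lambda>x. f x - g x) \<le> 2 * sq_norm (\<lambda>x. f x - 0) + 2 * sq_norm (\<lambda>x. 0 - g x)"
    using assms by (intro sq_norm_triangle) (auto simp: L2_iff)
  also have "\<dots> < \<infinity>" using assms by (simp add: L2_iff sq_norm_def ennreal_mult_less_top)
  finally show ?thesis using assms by (auto simp: L2_iff)
qed

lemma L2_if_sq_norm_diff:
  assumes "f \<in> L2" "g \<in> borel_measurable borel" "sq_norm (\<lambda>x. f x - g x) < \<infinity>"
  shows "g \<in> L2"
proof -
  have "(\<lambda>x. f x - g x) \<in> L2" using assms by (auto simp: L2_iff)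
  from L2_diff[OF assms(1) this] show ?thesis by simp
qed

text \<open>Cauchy-Schwarz in the form that evaluates integrals against an L2 limit: identities
  proved for truncations pass to \<open>fourier\<close> and \<open>inv_fourier\<close> by
  it.\<close>

lemma tendsto_L2_mult:
  fixes h :: "real \<Rightarrow> complex" and G :: "'a \<Rightarrow> real \<Rightarrow> complex"
  assumes h: "h \<in> L2" and g: "g \<in> L2" and G: "\<And>R. G R \<in> L2"
    and lim: "((\<lambda>R. sq_norm (\<lambda>x. G R x - g x)) \<longlongrightarrow> 0) F"
  shows "((\<lambda>R. LINT x|lborel. h x * G R x) \<longlongrightarrow> (LINT x|lborel. h x * g x)) F"
proof -
  define H where "H = (LINT x|lborel. (cmod (h x))\<^sup>2)"
  define D where "D R = (LINT x|lborel. (cmod (G R x - g x))\<^sup>2)" for R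
  have D: "sq_norm (\<lambda>x. G R x - g x) = ennreal (D R)" for R
    unfolding D_def by (rule sq_norm_eq[OF L2_diff[OF G g]])
  have D0: "D R \<ge> 0" for R by (simp add: D_def)
  have "(D \<longlongrightarrow> 0) F" using lim D0 unfolding D by (simp flip: ennreal_0)
  then have sq: "((\<lambda>R. sqrt (H * D R)) \<longlongrightarrow> 0) F"
    using tendsto_real_sqrt[OF tendsto_mult_left[of D 0 F H]] by simp
  have bd: "cmod ((LINT x|lborel. h x * G R x) - (LINT x|lborel. h x * g x)) \<le> sqrt (H * D R)" for R
  proof -
    have i: "integrable lborel (\<lambda>x. h x * (G R x - g x))"
      by (rule integrable_L2_mult[OF h L2_diff[OF G g]])
    have "(LINT x|lborel. h x * G R x) - (LINT x|lborel. h x * g x) = (LINT x|lborel. h x * (G R x - g x))"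
      using integrable_L2_mult[OF h G] integrable_L2_mult[OF h g]
      by (simp add: right_diff_distrib)
    also have "cmod \<dots> \<le> (LINT x|lborel. cmod (h x * (G R x - g x)))" by (rule integral_norm_bound)
    also have "\<dots> \<le> sqrt (H * D R)"
    proof (rule real_le_rsqrt)
      have "ennreal ((LINT x|lborel. cmod (h x * (G R x - g x)))\<^sup>2) = (\<integral>\<^sup>+ x. ennreal (cmod (h x * (G R x - g x))) \<partial>lborel)\<^sup>2"
        using i by (simp add: nn_integral_eq_integral ennreal_power)
      also have "\<dots> \<le> sq_norm h * sq_norm (\<lambda>x. G R x - g x)"
        by (rule Cauchy_Schwarz_sq_norm) (use h G g in auto)
      also have "\<dots> = ennreal (H * D R)"
        unfolding sq_norm_eq[OF h] D H_def[symmetric] by (simp add: ennreal_mult H_def D0)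
      finally show "(LINT x|lborel. cmod (h x * (G R x - g x)))\<^sup>2 \<le> H * D R"
        by (subst (asm) ennreal_le_iff) (auto simp: H_def D0)
    qed
    finally show ?thesis .
  qed
  show ?thesis
    by (rule Lim_null[THEN iffD2], rule Lim_null_comparison[OF _ sq]) (use bd in auto)
qed

text \<open>Riesz-Fischer by reduction to L1: multiplying by a strictly positive Gaussian
  \<open>w\<close> in \<open>L2\<close> makes the sequence Cauchy in L1 by Cauchy-Schwarz, so a
  subsequence converges almost everywhere. Dividing by \<open>w\<close> gives the limit
  \<open>g\<close>, and Fatou turns the Cauchy bounds into bounds against \<open>g\<close>.\<close>

lemma L2_complete:
  fixes s :: "nat \<Rightarrow> real \<Rightarrow> complex"
  assumes s: "\<And>n. s n \<in> L2"
    and cauchy: "\<And>e. e > 0 \<Longrightarrow> \<exists>N. \<forall>i\<ge>N. \<forall>j\<ge>N. sq_norm (\<lambda>x. s i x - s j x) \<le> ennreal e"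
  obtains g where "g \<in> L2" "(\<lambda>n. sq_norm (\<lambda>x. s n x - g x)) \<longlonglongrightarrow> 0"
proof -
  define w :: "real \<Rightarrow> complex" where "w x = of_real (exp (- x\<^sup>2 / 2))" for x
  have wpos: "w x \<noteq> 0" for x by (simp add: w_def)
  have [measurable]: "w \<in> borel_measurable borel" unfolding w_def by measurable
  have [measurable]: "s n \<in> borel_measurable borel" for n using s by auto
  \<comment> \<open>The square of \<open>w\<close> is exp (-x^2), the Gaussian with scale sqrt
    2.\<close>
  have "integrable lborel (\<lambda>x::real. exp (- (sqrt 2 * x)\<^sup>2 / 2))" by (rule integrable_gaussian) simp
  moreover have "(cmod (w x))\<^sup>2 = exp (- (sqrt 2 * x)\<^sup>2 / 2)" for x
    by (simp add: w_def power_mult_distrib power2_eq_square mult_exp_exp)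
  ultimately have wL2: "w \<in> L2" unfolding L2_def by simp
  define W where "W = (LINT x|lborel. (cmod (w x))\<^sup>2)"
  have W0: "W \<ge> 0" by (simp add: W_def)
  have tint: "integrable lborel (\<lambda>x. w x * s n x)" for n by (rule integrable_L2_mult[OF wL2 s])
  \<comment> \<open>The threshold e^2 / (4 (W + 1)) makes Cauchy-Schwarz give at most W / (W + 1) *
    (e / 2)^2. The added 1 covers \<open>W = 0\<close>, and e / 2 leaves room for the strict
    inequality.\<close>
  have L1: "\<exists>N. \<forall>i\<ge>N. \<forall>j\<ge>N. (LINT x|lborel. norm (w x * s i x - w x * s j x)) < e" if "e > 0" for e
  proof -
    have "e\<^sup>2 / (4 * (W + 1)) > 0" using that W0 by (simp add: add_nonneg_pos)
    from cauchy[OF this] obtain N where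
      N: "\<And>i j. i \<ge> N \<Longrightarrow> j \<ge> N \<Longrightarrow> sq_norm (\<lambda>x. s i x - s j x) \<le> ennreal (e\<^sup>2 / (4 * (W + 1)))" by auto
    show ?thesis
    proof (intro exI allI impI)
      fix i j assume ij: "i \<ge> N" "j \<ge> N"
      let ?I = "LINT x|lborel. norm (w x * s i x - w x * s j x)"
      have "ennreal (?I\<^sup>2) = (\<integral>\<^sup>+ x. ennreal (norm (w x * (s i x - s j x))) \<partial>lborel)\<^sup>2"
        using tint[of i] tint[of j] by (simp add: nn_integral_eq_integral right_diff_distrib ennreal_power)
      also have "\<dots> \<le> sq_norm w * sq_norm (\<lambda>x. s i x - s j x)" by (rule Cauchy_Schwarz_sq_norm) auto
      also have "\<dots> \<le> ennreal W * ennreal (e\<^sup>2 / (4 * (W + 1)))"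
        unfolding sq_norm_eq[OF wL2] W_def[symmetric] by (intro mult_left_mono N ij) auto
      also have "\<dots> = ennreal (W * (e\<^sup>2 / (4 * (W + 1))))" using W0 by (intro ennreal_mult[symmetric]) auto
      finally have "?I\<^sup>2 \<le> W * (e\<^sup>2 / (4 * (W + 1)))"
        by (subst (asm) ennreal_le_iff) (use W0 in auto)
      also have "\<dots> = W / (W + 1) * (e / 2)\<^sup>2" by (simp add: power_divide)
      also have "\<dots> \<le> 1 * (e / 2)\<^sup>2" using W0 by (intro mult_right_mono) auto
      finally have "?I\<^sup>2 \<le> (e / 2)\<^sup>2" unfolding mult_1_left .
      then have "?I \<le> e / 2" by (rule power2_le_imp_le) (use that in simp)
      then show "?I < e" using that by linarith
    qed
  qed
  obtain r where r: "strict_mono r" and C: "AE x in lborel. Cauchy (\<lambda>i. w x * s (r i) x)"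
    by (rule cauchy_L1_AE_cauchy_subseq[of lborel "\<lambda>n x. w x * s n x", OF tint L1])
  define g where "g x = lim (\<lambda>i. s (r i) x)" for x
  have [measurable]: "g \<in> borel_measurable borel" unfolding g_def by measurable
  have conv: "AE x in lborel. (\<lambda>i. s (r i) x) \<longlonglongrightarrow> g x"
    using C
  proof eventually_elim
    case (elim x)
    then obtain l where "(\<lambda>i. w x * s (r i) x) \<longlonglongrightarrow> l"
      by (auto simp: Cauchy_convergent_iff convergent_def)
    from tendsto_mult_left[OF this, of "inverse (w x)"]
    have "(\<lambda>i. s (r i) x) \<longlonglongrightarrow> inverse (w x) * l"
      using wpos[of x] by (simp add: mult.assoc[symmetric])
    then show ?case unfolding g_def by (simp add: limI)
  qed
  have fatou: "\<exists>N. \<forall>n\<ge>N. sq_norm (\<lambda>x. s n x - g x) \<le> ennreal e" if "e > 0" for e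
  proof -
    from cauchy[OF that] obtain N where
      N: "\<And>i j. i \<ge> N \<Longrightarrow> j \<ge> N \<Longrightarrow> sq_norm (\<lambda>x. s i x - s j x) \<le> ennreal e" by auto
    have "sq_norm (\<lambda>x. s n x - g x) \<le> ennreal e" if "n \<ge> N" for n
    proof -
      have "sq_norm (\<lambda>x. s n x - g x) = (\<integral>\<^sup>+ x. liminf (\<lambda>i. ennreal ((cmod (s n x - s (r i) x))\<^sup>2)) \<partial>lborel)"
        unfolding sq_norm_def
      proof (rule nn_integral_cong_AE)
        show "AE x in lborel. ennreal ((cmod (s n x - g x))\<^sup>2) = liminf (\<lambda>i. ennreal ((cmod (s n x - s (r i) x))\<^sup>2))"
          using conv
        proof eventually_elim
          case (elim x)
          have "(\<lambda>i. ennreal ((cmod (s n x - s (r i) x))\<^sup>2)) \<longlonglongrightarrow> ennreal ((cmod (s n x - g x))\<^sup>2)"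
            by (intro tendsto_ennrealI tendsto_intros elim)
          then show ?case by (rule lim_imp_Liminf[OF trivial_limit_sequentially, symmetric])
        qed
      qed
      also have "\<dots> \<le> liminf (\<lambda>i. sq_norm (\<lambda>x. s n x - s (r i) x))"
        unfolding sq_norm_def by (rule nn_integral_liminf) measurable
      also have "\<dots> \<le> liminf (\<lambda>i. ennreal e)"
      proof (rule Liminf_mono)
        show "\<forall>\<^sub>F i in sequentially. sq_norm (\<lambda>x. s n x - s (r i) x) \<le> ennreal e"
          unfolding eventually_sequentially
          using N[OF that] seq_suble[OF r] by (intro exI[of _ N]) (auto intro: order_trans)
      qed
      also have "\<dots> = ennreal e" by (simp add: Liminf_const)
      finally show ?thesis .
    qed
    then show ?thesis by auto
  qed
  have "g \<in> L2"
  proof -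
    from fatou[of 1] obtain N where "sq_norm (\<lambda>x. s N x - g x) \<le> ennreal 1" by auto
    also have "\<dots> < \<infinity>" by simp
    finally show ?thesis by (intro L2_if_sq_norm_diff[OF s[of N]]) auto
  qed
  moreover have "(\<lambda>n. sq_norm (\<lambda>x. s n x - g x)) \<longlonglongrightarrow> 0"
  proof (rule order_tendstoI)
    fix a :: ennreal assume "0 < a"
    then obtain b where b: "0 < b" "b < a" using dense by blast
    then have "b \<noteq> \<top>" by auto
    then obtain e where "0 < e" "ennreal e < a"
      using b by (cases b) auto
    from fatou[OF \<open>0 < e\<close>] obtain N where "\<And>n. n \<ge> N \<Longrightarrow> sq_norm (\<lambda>x. s n x - g x) \<le> ennreal e" by auto
    then show "\<forall>\<^sub>F n in sequentially. sq_norm (\<lambda>x. s n x - g x) < a"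
      unfolding eventually_sequentially using \<open>ennreal e < a\<close> by (intro exI[of _ N]) (auto intro: order.strict_trans1)
  qed simp
  ultimately show thesis by (rule that)
qed

section \<open>Plancherel's inequality and the \<open>L\<^sup>2\<close> Fourier transform\<close>

lemma integral_shift:
  fixes f :: "real \<Rightarrow> 'a::{banach, second_countable_topology}"
  shows "(LINT x|lborel. f (x + a)) = (LINT x|lborel. f x)"
  using lborel_integral_real_affine[of 1 f a] by (simp add: add.commute)

lemma L2_affine:
  assumes "f \<in> L2" "c \<noteq> 0"
  shows "(\<lambda>x. f (a + c * x)) \<in> L2"
proof -
  have [measurable]: "f \<in> borel_measurable borel" using assms by auto
  have "(\<lambda>x. f (a + c * x)) \<in> borel_measurable lborel" by measurable
  then show ?thesis
    using lborel_integrable_real_affine[OF L2_integrable[OF assms(1)] assms(2), of a] unfolding L2_def by simp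
qed

lemma L2_shift: "f \<in> L2 \<Longrightarrow> (\<lambda>x. f (x + a)) \<in> L2"
  using L2_affine[of f 1 a] by (simp add: add.commute)

lemma L2_reflect: "f \<in> L2 \<Longrightarrow> (\<lambda>x. f (- x)) \<in> L2"
  using L2_affine[of f "-1" 0] by simp

lemma sq_norm_reflect:
  assumes [measurable]: "f \<in> borel_measurable borel"
  shows "sq_norm (\<lambda>x. f (- x)) = sq_norm f"
  unfolding sq_norm_def
  using nn_integral_real_affine[of "\<lambda>x. ennreal ((cmod (f x))\<^sup>2)" "-1" 0] by simp

lemma sq_norm_cmult:
  assumes [measurable]: "f \<in> borel_measurable borel"
  shows "sq_norm (\<lambda>x. c * f x) = ennreal ((cmod c)\<^sup>2) * sq_norm f"
  unfolding sq_norm_def by (simp add: norm_mult power_mult_distrib ennreal_mult nn_integral_cmult)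

lemma L2_cmult: "f \<in> L2 \<Longrightarrow> (\<lambda>x. c * f x) \<in> L2"
  by (rule L2_bound[where B="cmod c"]) (auto simp: norm_mult)

lemma tendsto_gaussian_weight:
  "(\<lambda>n. exp (- (1 / real (Suc n) * \<xi>)\<^sup>2 / 2)) \<longlonglongrightarrow> 1"
proof -
  have "(\<lambda>n. exp (- (1 / real (Suc n) * \<xi>)\<^sup>2 / 2)) \<longlonglongrightarrow> exp (- (0 * \<xi>)\<^sup>2 / 2)"
    using LIMSEQ_inverse_real_of_nat by (intro tendsto_intros) (simp_all add: inverse_eq_divide)
  then show ?thesis by simp
qed

text \<open>\<open>smoothed_parseval\<close> with the conjugate of \<open>f\<close> turns the
  Gaussian-weighted integral of |FT f|^2 into an average of autocorrelations of \<open>f\<close>,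
  each at most \<open>C\<close> in modulus. As the weight tends to 1, Fatou yields the inequality,
  which is what transports Cauchy sequences.\<close>

lemma Plancherel_le:
  assumes f: "integrable lborel f" and f2: "f \<in> L2"
  shows "sq_norm (FT f) \<le> ennreal (2 * pi) * sq_norm f"
proof -
  have [measurable]: "f \<in> borel_measurable borel" using f2 by auto
  have [measurable]: "FT f \<in> borel_measurable borel" using borel_measurable_FT[of f] by simp
  define C where "C = (LINT x|lborel. (cmod (f x))\<^sup>2)"
  define w where "w n \<xi> = exp (- (1 / real (Suc n) * \<xi>)\<^sup>2 / 2)" for n \<xi>
  have A: "cmod (LINT y|lborel. f (y + a) * cnj (f y)) \<le> C" for a
  proof -
    have i: "integrable lborel (\<lambda>y. f (y + a) * cnj (f y))"
      by (rule integrable_L2_mult[OF L2_shift[OF f2]], rule L2_bound[OF f2, of _ 1])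
        (use f borel_measurable_integrable[of lborel "\<lambda>x. cnj (f x)"] in auto)
    have i2: "integrable lborel (\<lambda>y. ((cmod (f (y + a)))\<^sup>2 + (cmod (f y))\<^sup>2) / 2)"
      using L2_integrable[OF f2] L2_integrable[OF L2_shift[OF f2, of a]] by simp
    have "cmod (LINT y|lborel. f (y + a) * cnj (f y)) \<le> (LINT y|lborel. cmod (f (y + a) * cnj (f y)))"
      by (rule integral_norm_bound)
    also have "\<dots> \<le> (LINT y|lborel. ((cmod (f (y + a)))\<^sup>2 + (cmod (f y))\<^sup>2) / 2)"
    proof (rule integral_mono[OF integrable_norm[OF i] i2])
      fix y show "cmod (f (y + a) * cnj (f y)) \<le> ((cmod (f (y + a)))\<^sup>2 + (cmod (f y))\<^sup>2) / 2"
        using sum_squares_bound[of "cmod (f (y + a))" "cmod (f y)"] by (simp add: norm_mult)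
    qed
    also have "\<dots> = ((LINT y|lborel. (cmod (f (y + a)))\<^sup>2) + (LINT y|lborel. (cmod (f y))\<^sup>2)) / 2"
      using L2_integrable[OF f2] L2_integrable[OF L2_shift[OF f2, of a]] by simp
    also have "\<dots> = C" using integral_shift[of "\<lambda>y. (cmod (f y))\<^sup>2" a] by (simp add: C_def)
    finally show ?thesis .
  qed
  have C0: "C \<ge> 0" by (simp add: C_def)
  have le: "(\<integral>\<^sup>+ \<xi>. ennreal ((cmod (FT f \<xi>))\<^sup>2 * w n \<xi>) \<partial>lborel) \<le> ennreal (2 * pi * C)" for n
  proof -
    let ?e = "1 / real (Suc n)"
    have e: "?e > 0" by simp
    have cn: "integrable lborel (\<lambda>x. cnj (f x))" using f by simp
    have iw: "integrable lborel (\<lambda>\<xi>. (cmod (FT f \<xi>))\<^sup>2 * w n \<xi>)"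
    proof (rule Bochner_Integration.integrable_bound)
      show "integrable lborel (\<lambda>\<xi>. (LINT x|lborel. cmod (f x))\<^sup>2 * w n \<xi>)"
        unfolding w_def using integrable_gaussian[OF e] by simp
      show "AE \<xi> in lborel. norm ((cmod (FT f \<xi>))\<^sup>2 * w n \<xi>) \<le> norm ((LINT x|lborel. cmod (f x))\<^sup>2 * w n \<xi>)"
        using norm_FT_le[OF f] by (intro AE_I2) (auto simp: w_def abs_mult intro!: mult_right_mono power_mono)
    qed (simp add: w_def)
    have "of_real (LINT \<xi>|lborel. (cmod (FT f \<xi>))\<^sup>2 * w n \<xi>)
      = (LINT \<xi>|lborel. FT f \<xi> * FT (\<lambda>x. cnj (f x)) (- \<xi>) * of_real (exp (- (?e * \<xi>)\<^sup>2 / 2)))"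
      unfolding FT_cnj w_def complex_norm_square[symmetric] of_real_mult[symmetric]
      by (subst integral_complex_of_real[symmetric]) simp
    also have "\<dots> = 2 * pi * (LINT s|lborel. of_real (std_normal_density s) * (LINT y|lborel. f (y + ?e * s) * cnj (f y)))"
      by (rule smoothed_parseval[OF f cn e])
    finally have "(LINT \<xi>|lborel. (cmod (FT f \<xi>))\<^sup>2 * w n \<xi>)
      \<le> cmod (2 * pi * (LINT s|lborel. of_real (std_normal_density s) * (LINT y|lborel. f (y + ?e * s) * cnj (f y))))"
      by (metis norm_of_real abs_ge_self)
    also have "\<dots> = 2 * pi * cmod (LINT s|lborel. of_real (std_normal_density s) * (LINT y|lborel. f (y + ?e * s) * cnj (f y)))"
      by (simp add: norm_mult)
    also have "cmod (LINT s|lborel. of_real (std_normal_density s) * (LINT y|lborel. f (y + ?e * s) * cnj (f y)))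
      \<le> (LINT s|lborel. std_normal_density s * C)"
    proof (rule order_trans[OF integral_norm_bound integral_mono])
      have i: "integrable lborel (\<lambda>s. std_normal_density s * C)" by simp
      then show "integrable lborel (\<lambda>s. std_normal_density s * C)" .
      have b: "cmod (complex_of_real (std_normal_density s) * (LINT y|lborel. f (y + ?e * s) * cnj (f y))) \<le> std_normal_density s * C" for s
        using A[of "?e * s"] by (simp add: norm_mult normal_density_nonneg mult_left_mono)
      then show "cmod (complex_of_real (std_normal_density s) * (LINT y|lborel. f (y + ?e * s) * cnj (f y))) \<le> std_normal_density s * C" for s .
      show "integrable lborel (\<lambda>s. cmod (complex_of_real (std_normal_density s) * (LINT y|lborel. f (y + ?e * s) * cnj (f y))))"
      proof (rule integrable_norm, rule Bochner_Integration.integrable_bound[OF i])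
        have [measurable]: "(\<lambda>x. cnj (f x)) \<in> borel_measurable borel"
          using borel_measurable_integrable[OF cn] by simp
        show "(\<lambda>s. complex_of_real (std_normal_density s) * (LINT y|lborel. f (y + ?e * s) * cnj (f y))) \<in> borel_measurable lborel"
          by measurable
        show "AE s in lborel. norm (complex_of_real (std_normal_density s) * (LINT y|lborel. f (y + ?e * s) * cnj (f y)))
          \<le> norm (std_normal_density s * C)"
          by (rule AE_I2, rule order_trans[OF b]) simp
      qed
    qed
    also have "(LINT s|lborel. std_normal_density s * C) = C" by simp
    finally have "(LINT \<xi>|lborel. (cmod (FT f \<xi>))\<^sup>2 * w n \<xi>) \<le> 2 * pi * C" by simp
    then show ?thesis
      by (subst nn_integral_eq_integral[OF iw]) (auto simp: w_def intro: ennreal_leI)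
  qed
  have "sq_norm (FT f) = (\<integral>\<^sup>+ \<xi>. liminf (\<lambda>n. ennreal ((cmod (FT f \<xi>))\<^sup>2 * w n \<xi>)) \<partial>lborel)"
    unfolding sq_norm_def
  proof (rule nn_integral_cong)
    fix \<xi>
    have "(\<lambda>n. ennreal ((cmod (FT f \<xi>))\<^sup>2 * w n \<xi>)) \<longlonglongrightarrow> ennreal ((cmod (FT f \<xi>))\<^sup>2 * 1)"
      unfolding w_def by (intro tendsto_ennrealI tendsto_mult tendsto_const tendsto_gaussian_weight)
    then show "ennreal ((cmod (FT f \<xi>))\<^sup>2) = liminf (\<lambda>n. ennreal ((cmod (FT f \<xi>))\<^sup>2 * w n \<xi>))"
      by (simp add: lim_imp_Liminf[OF trivial_limit_sequentially])
  qed
  also have "\<dots> \<le> liminf (\<lambda>n. \<integral>\<^sup>+ \<xi>. ennreal ((cmod (FT f \<xi>))\<^sup>2 * w n \<xi>) \<partial>lborel)"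
    by (rule nn_integral_liminf) (auto simp: w_def)
  also have "\<dots> \<le> liminf (\<lambda>n::nat. ennreal (2 * pi * C))"
    by (rule Liminf_mono) (use le in auto)
  also have "\<dots> = ennreal (2 * pi) * sq_norm f"
    unfolding sq_norm_eq[OF f2] C_def[symmetric] using C0 by (simp add: Liminf_const ennreal_mult)
  finally show ?thesis .
qed

lemma FT_in_L2:
  assumes f: "integrable lborel f" and f2: "f \<in> L2"
  shows "FT f \<in> L2"
proof -
  have "sq_norm (FT f) < \<infinity>"
    using f2 by (intro order.strict_trans1[OF Plancherel_le[OF f f2]]) (auto simp: L2_iff ennreal_mult_less_top)
  then show ?thesis using borel_measurable_FT[of f] f2 by (auto simp: L2_iff)
qed

lemma FT_diff:
  assumes "integrable lborel f" "integrable lborel g"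
  shows "FT (\<lambda>x. f x - g x) \<xi> = FT f \<xi> - FT g \<xi>"
  unfolding FT_def using integrable_exp_mult[OF assms(1)] integrable_exp_mult[OF assms(2)]
  by (simp add: right_diff_distrib)

section \<open>Truncations and the L2 limits of their transforms\<close>

definition trunc :: "real \<Rightarrow> (real \<Rightarrow> complex) \<Rightarrow> real \<Rightarrow> complex" where
  "trunc R f x = indicat_real {-R..R} x *\<^sub>R f x"

lemma trunc_measurable [measurable]: "f \<in> borel_measurable borel \<Longrightarrow> trunc R f \<in> borel_measurable borel"
  unfolding trunc_def by measurable

lemma trunc_L2: "f \<in> L2 \<Longrightarrow> trunc R f \<in> L2"
  by (rule L2_bound[where B=1]) (auto simp: trunc_def indicator_def)

lemma trunc_integrable:
  assumes f: "f \<in> L2"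
  shows "integrable lborel (trunc R f)"
proof (rule Bochner_Integration.integrable_bound)
  show "integrable lborel (\<lambda>x. indicat_real {-R..R} x + (cmod (f x))\<^sup>2)"
    using L2_integrable[OF f]
    by (intro Bochner_Integration.integrable_add integrable_real_indicator) (auto simp: emeasure_lborel_Icc_eq)
  show "AE x in lborel. norm (trunc R f x) \<le> norm (indicat_real {-R..R} x + (cmod (f x))\<^sup>2)"
  proof (rule AE_I2)
    fix x show "norm (trunc R f x) \<le> norm (indicat_real {-R..R} x + (cmod (f x))\<^sup>2)"
    proof -
      have "2 * cmod (f x) \<le> 1 + (cmod (f x))\<^sup>2" using sum_squares_bound[of "1" "cmod (f x)"] by simp
      then have "cmod (f x) \<le> 1 + (cmod (f x))\<^sup>2" using zero_le_power2[of "cmod (f x)"] by linarith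
      then show ?thesis by (auto simp: trunc_def indicator_def)
    qed
  qed
qed (use f in measurable)

lemma trunc_tendsto:
  assumes f: "f \<in> L2"
  shows "((\<lambda>R. sq_norm (\<lambda>x. trunc R f x - f x)) \<longlongrightarrow> 0) at_top"
proof (rule tendsto_at_topI_sequentially)
  fix X :: "nat \<Rightarrow> real" assume X: "filterlim X at_top sequentially"
  have [measurable]: "f \<in> borel_measurable borel" using f by auto
  have "(\<lambda>n. sq_norm (\<lambda>x. trunc (X n) f x - f x)) \<longlonglongrightarrow> nn_integral lborel (\<lambda>x::real. 0)"
    unfolding sq_norm_def
  proof (rule nn_integral_dominated_convergence)
    show "(\<integral>\<^sup>+ x. ennreal ((cmod (f x))\<^sup>2) \<partial>lborel) < \<infinity>" using f by (simp add: L2_iff sq_norm_def)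
    show "AE x in lborel. (\<lambda>n. ennreal ((cmod (trunc (X n) f x - f x))\<^sup>2)) \<longlonglongrightarrow> 0"
    proof (rule AE_I2)
      fix x
      have "\<forall>\<^sub>F n in sequentially. X n \<ge> \<bar>x\<bar>" using X by (auto simp: filterlim_at_top)
      then have "\<forall>\<^sub>F n in sequentially. ennreal ((cmod (trunc (X n) f x - f x))\<^sup>2) = 0"
        by eventually_elim (auto simp: trunc_def indicator_def abs_le_iff)
      then show "(\<lambda>n. ennreal ((cmod (trunc (X n) f x - f x))\<^sup>2)) \<longlonglongrightarrow> 0" by (rule tendsto_eventually)
    qed
  qed (auto simp: trunc_def indicator_def)
  then show "(\<lambda>n. sq_norm (\<lambda>x. trunc (X n) f x - f x)) \<longlonglongrightarrow> 0" by simp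
qed

lemma sq_norm_FT_trunc_diff:
  assumes f: "f \<in> L2"
  shows "sq_norm (\<lambda>\<xi>. FT (trunc R f) \<xi> - FT (trunc S f) \<xi>)
    \<le> ennreal (4 * pi) * (sq_norm (\<lambda>x. trunc R f x - f x) + sq_norm (\<lambda>x. trunc S f x - f x))"
proof -
  have [measurable]: "f \<in> borel_measurable borel" using f by auto
  note t = trunc_integrable[OF f] trunc_L2[OF f]
  have "sq_norm (\<lambda>\<xi>. FT (trunc R f) \<xi> - FT (trunc S f) \<xi>) = sq_norm (FT (\<lambda>x. trunc R f x - trunc S f x))"
    by (intro arg_cong[where f=sq_norm] ext FT_diff[symmetric] t)
  also have "\<dots> \<le> ennreal (2 * pi) * sq_norm (\<lambda>x. trunc R f x - trunc S f x)"
    by (rule Plancherel_le) (use t in \<open>auto intro: L2_diff\<close>)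
  also have "\<dots> \<le> ennreal (2 * pi) * (2 * sq_norm (\<lambda>x. trunc R f x - f x) + 2 * sq_norm (\<lambda>x. f x - trunc S f x))"
    by (intro mult_left_mono sq_norm_triangle) auto
  also have "\<dots> = ennreal (2 * pi) * 2 * (sq_norm (\<lambda>x. trunc R f x - f x) + sq_norm (\<lambda>x. trunc S f x - f x))"
    unfolding sq_norm_minus_commute[of f] by (simp add: distrib_left mult.assoc)
  also have "ennreal (2 * pi) * 2 = ennreal (4 * pi)"
    using ennreal_mult[of "2 * pi" 2] by simp
  finally show ?thesis .
qed

text \<open>Completeness yields a limit along integer radii. For an arbitrary sequence of radii
  tending to infinity, the transform at the n-th radius is compared with the one at radius n, which
  gives the limit over all real radii.\<close>

lemma FT_trunc_convergent:
  assumes f: "f \<in> L2"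
  obtains g where "g \<in> L2" "((\<lambda>R. sq_norm (\<lambda>\<xi>. FT (trunc R f) \<xi> - g \<xi>)) \<longlongrightarrow> 0) at_top"
proof -
  let ?T = "\<lambda>R. sq_norm (\<lambda>x. trunc R f x - f x)"
  note t = trunc_integrable[OF f] trunc_L2[OF f]
  have L2: "FT (trunc R f) \<in> L2" for R by (rule FT_in_L2[OF t])
  have Tn: "(\<lambda>n. ?T (real n)) \<longlonglongrightarrow> 0"
    using filterlim_compose[OF trunc_tendsto[OF f] filterlim_real_sequentially] .
  have "\<exists>N. \<forall>i\<ge>N. \<forall>j\<ge>N. sq_norm (\<lambda>x. FT (trunc (real i) f) x - FT (trunc (real j) f) x) \<le> ennreal e" if "e > 0" for e
  proof -
    \<comment> \<open>Two errors of e / (8 pi), multiplied by the constant 4 pi of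
      \<open>sq_norm_FT_trunc_diff\<close>, add up to e.\<close>
    have "0 < ennreal (e / (8 * pi))" using that by simp
    from order_tendstoD(2)[OF Tn this] obtain N where N: "\<And>n. n \<ge> N \<Longrightarrow> ?T (real n) < ennreal (e / (8 * pi))"
      by (auto simp: eventually_sequentially)
    show ?thesis
    proof (intro exI allI impI)
      fix i j assume ij: "i \<ge> N" "j \<ge> N"
      have "sq_norm (\<lambda>x. FT (trunc (real i) f) x - FT (trunc (real j) f) x) \<le> ennreal (4 * pi) * (?T (real i) + ?T (real j))"
        by (rule sq_norm_FT_trunc_diff[OF f])
      also have "\<dots> \<le> ennreal (4 * pi) * (ennreal (e / (8 * pi)) + ennreal (e / (8 * pi)))"
        using N[OF ij(1)] N[OF ij(2)] by (intro mult_left_mono add_mono) auto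
      also have "ennreal (e / (8 * pi)) + ennreal (e / (8 * pi)) = ennreal (e / (8 * pi) + e / (8 * pi))"
        by (rule ennreal_plus[symmetric]) (use that in simp_all)
      also have "ennreal (4 * pi) * \<dots> = ennreal (4 * pi * (e / (8 * pi) + e / (8 * pi)))"
        by (rule ennreal_mult[symmetric]) (use that in simp_all)
      also have "4 * pi * (e / (8 * pi) + e / (8 * pi)) = e" by simp
      finally show "sq_norm (\<lambda>x. FT (trunc (real i) f) x - FT (trunc (real j) f) x) \<le> ennreal e" .
    qed
  qed
  from L2_complete[of "\<lambda>n. FT (trunc (real n) f)", OF L2 this] obtain g where
    g: "g \<in> L2" "(\<lambda>n. sq_norm (\<lambda>x. FT (trunc (real n) f) x - g x)) \<longlonglongrightarrow> 0" by blast
  have "((\<lambda>R. sq_norm (\<lambda>\<xi>. FT (trunc R f) \<xi> - g \<xi>)) \<longlongrightarrow> 0) at_top"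
  proof (rule tendsto_at_topI_sequentially)
    fix X :: "nat \<Rightarrow> real" assume X: "filterlim X at_top sequentially"
    have lim: "(\<lambda>n. 2 * (ennreal (4 * pi) * (?T (X n) + ?T (real n))) + 2 * sq_norm (\<lambda>x. FT (trunc (real n) f) x - g x))
       \<longlonglongrightarrow> 2 * (ennreal (4 * pi) * (0 + 0)) + 2 * 0"
      by (intro tendsto_add ennreal_tendsto_cmult g(2) Tn filterlim_compose[OF trunc_tendsto[OF f] X]) auto
    show "(\<lambda>n. sq_norm (\<lambda>\<xi>. FT (trunc (X n) f) \<xi> - g \<xi>)) \<longlonglongrightarrow> 0"
    proof (rule tendsto_sandwich[OF _ _ tendsto_const])
      show "\<forall>\<^sub>F n in sequentially. sq_norm (\<lambda>\<xi>. FT (trunc (X n) f) \<xi> - g \<xi>)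
        \<le> 2 * (ennreal (4 * pi) * (?T (X n) + ?T (real n))) + 2 * sq_norm (\<lambda>x. FT (trunc (real n) f) x - g x)"
      proof (rule always_eventually, rule allI)
        fix n
        have "sq_norm (\<lambda>\<xi>. FT (trunc (X n) f) \<xi> - g \<xi>)
          \<le> 2 * sq_norm (\<lambda>\<xi>. FT (trunc (X n) f) \<xi> - FT (trunc (real n) f) \<xi>) + 2 * sq_norm (\<lambda>x. FT (trunc (real n) f) x - g x)"
          by (rule sq_norm_triangle) (use L2 g in auto)
        also have "\<dots> \<le> 2 * (ennreal (4 * pi) * (?T (X n) + ?T (real n))) + 2 * sq_norm (\<lambda>x. FT (trunc (real n) f) x - g x)"
          by (intro add_mono mult_left_mono sq_norm_FT_trunc_diff f) auto
        finally show "sq_norm (\<lambda>\<xi>. FT (trunc (X n) f) \<xi> - g \<xi>) \<le> \<dots>" .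
      qed
    qed (use lim in auto)
  qed
  with g(1) show thesis by (rule that)
qed

text \<open>\<open>SOME\<close> picks a limit once one exists. Everything later relies on just these
  two properties, whichever representative is chosen.\<close>

lemma L2_lim_spec:
  assumes "g \<in> L2" "((\<lambda>R. sq_norm (\<lambda>x. F R x - g x)) \<longlongrightarrow> 0) at_top"
  shows "L2_lim F \<in> L2 \<and> ((\<lambda>R. sq_norm (\<lambda>x. F R x - L2_lim F x)) \<longlongrightarrow> 0) at_top"
  unfolding L2_lim_def sq_norm_def by (rule someI[of _ g]) (use assms in \<open>auto simp: sq_norm_def\<close>)

lemma fourier_spec:
  assumes f: "f \<in> L2"
  shows "fourier f \<in> L2" "((\<lambda>R. sq_norm (\<lambda>\<xi>. FT (trunc R f) \<xi> - fourier f \<xi>)) \<longlongrightarrow> 0) at_top"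
proof -
  have eq: "fourier f = L2_lim (\<lambda>R. FT (trunc R f))"
    unfolding fourier_def FT_def trunc_def set_lebesgue_integral_def by simp
  obtain g where "g \<in> L2" "((\<lambda>R. sq_norm (\<lambda>\<xi>. FT (trunc R f) \<xi> - g \<xi>)) \<longlongrightarrow> 0) at_top"
    using FT_trunc_convergent[OF f] .
  from L2_lim_spec[OF this] show "fourier f \<in> L2" "((\<lambda>R. sq_norm (\<lambda>\<xi>. FT (trunc R f) \<xi> - fourier f \<xi>)) \<longlongrightarrow> 0) at_top"
    unfolding eq by auto
qed

text \<open>Up to the factor 1 / (2 pi), the truncated inverse integral at \<open>x\<close> is
  \<open>FT\<close> at \<open>- x\<close>, so the limit found for \<open>FT\<close> supplies the
  witness after reflection and scaling.\<close>

lemma inv_fourier_spec: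
  assumes f: "f \<in> L2"
  shows "inv_fourier f \<in> L2"
    "((\<lambda>R. sq_norm (\<lambda>x. 1 / (2 * of_real pi) * FT (trunc R f) (- x) - inv_fourier f x)) \<longlongrightarrow> 0) at_top"
proof -
  let ?c = "1 / (2 * complex_of_real pi)"
  have [measurable]: "f \<in> borel_measurable borel" using f by auto
  have eq: "inv_fourier f = L2_lim (\<lambda>R x. ?c * FT (trunc R f) (- x))"
    unfolding inv_fourier_def FT_def trunc_def set_lebesgue_integral_def by (simp add: mult.commute)
  obtain g where g: "g \<in> L2" "((\<lambda>R. sq_norm (\<lambda>\<xi>. FT (trunc R f) \<xi> - g \<xi>)) \<longlongrightarrow> 0) at_top"
    using FT_trunc_convergent[OF f] .
  have [measurable]: "g \<in> borel_measurable borel" using g by auto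
  have [measurable]: "FT (trunc R f) \<in> borel_measurable borel" for R using borel_measurable_FT[of "trunc R f"] by simp
  have "sq_norm (\<lambda>x. ?c * FT (trunc R f) (- x) - ?c * g (- x)) = ennreal ((cmod ?c)\<^sup>2) * sq_norm (\<lambda>x. FT (trunc R f) x - g x)" for R
  proof -
    have "sq_norm (\<lambda>x. ?c * FT (trunc R f) (- x) - ?c * g (- x)) = sq_norm (\<lambda>x. ?c * (\<lambda>x. FT (trunc R f) x - g x) (- x))"
      by (simp add: right_diff_distrib)
    also have "\<dots> = sq_norm (\<lambda>x. ?c * (FT (trunc R f) x - g x))"
      using sq_norm_reflect[of "\<lambda>x. ?c * (FT (trunc R f) x - g x)"] by simp
    also have "\<dots> = ennreal ((cmod ?c)\<^sup>2) * sq_norm (\<lambda>x. FT (trunc R f) x - g x)" by (rule sq_norm_cmult) measurable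
    finally show ?thesis .
  qed
  then have "((\<lambda>R. sq_norm (\<lambda>x. ?c * FT (trunc R f) (- x) - ?c * g (- x))) \<longlongrightarrow> ennreal ((cmod ?c)\<^sup>2) * 0) at_top"
    using ennreal_tendsto_cmult[OF _ g(2), of "ennreal ((cmod ?c)\<^sup>2)"] by simp
  moreover have "(\<lambda>x. ?c * g (- x)) \<in> L2" by (intro L2_cmult L2_reflect g)
  ultimately have "L2_lim (\<lambda>R x. ?c * FT (trunc R f) (- x)) \<in> L2 \<and>
    ((\<lambda>R. sq_norm (\<lambda>x. ?c * FT (trunc R f) (- x) - L2_lim (\<lambda>R x. ?c * FT (trunc R f) (- x)) x)) \<longlongrightarrow> 0) at_top"
    by (intro L2_lim_spec) auto
  then show "inv_fourier f \<in> L2"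
    "((\<lambda>R. sq_norm (\<lambda>x. 1 / (2 * of_real pi) * FT (trunc R f) (- x) - inv_fourier f x)) \<longlongrightarrow> 0) at_top"
    unfolding eq by auto
qed

section \<open>Parseval's identity\<close>

lemma measurable_FT_borel [measurable]: "f \<in> borel_measurable borel \<Longrightarrow> FT f \<in> borel_measurable borel"
  using borel_measurable_FT[of f] by simp

lemma FT_exchange:
  fixes f g :: "real \<Rightarrow> complex"
  assumes f: "integrable lborel f" and g: "integrable lborel g"
  shows "(LINT x|lborel. f x * FT g (- x)) = (LINT \<xi>|lborel. g \<xi> * FT f (- \<xi>))"
proof -
  let ?e = "\<lambda>x \<xi>. exp (\<i> * of_real (x * \<xi>))"
  have "(LINT x|lborel. f x * FT g (- x)) = (LINT x|lborel. (LINT \<xi>|lborel. ?e x \<xi> * f x * g \<xi>))"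
  proof (rule Bochner_Integration.integral_cong[OF refl])
    fix x
    have "(LINT \<xi>|lborel. ?e x \<xi> * f x * g \<xi>) = (LINT \<xi>|lborel. f x * (exp (- (\<i> * of_real (\<xi> * - x))) * g \<xi>))"
      by (intro Bochner_Integration.integral_cong) (auto simp: ac_simps)
    then show "f x * FT g (- x) = (LINT \<xi>|lborel. ?e x \<xi> * f x * g \<xi>)" unfolding FT_def by simp
  qed
  also have "\<dots> = (LINT \<xi>|lborel. (LINT x|lborel. ?e x \<xi> * f x * g \<xi>))"
    by (rule lborel_pair.Fubini_integral[symmetric], rule integrable_kernel[OF f g, where B=1]) auto
  also have "\<dots> = (LINT \<xi>|lborel. g \<xi> * FT f (- \<xi>))"
  proof (rule Bochner_Integration.integral_cong[OF refl])
    fix \<xi>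
    have "(LINT x|lborel. ?e x \<xi> * f x * g \<xi>) = (LINT x|lborel. g \<xi> * (exp (- (\<i> * of_real (x * - \<xi>))) * f x))"
      by (intro Bochner_Integration.integral_cong) (auto simp: ac_simps)
    then show "(LINT x|lborel. ?e x \<xi> * f x * g \<xi>) = g \<xi> * FT f (- \<xi>)" unfolding FT_def by simp
  qed
  finally show ?thesis .
qed

text \<open>Continuity of translation in L1 enters here: for bounded \<open>g\<close> the
  correlation with \<open>f\<close> is continuous at lag 0. The uniform bound is the majorant for
  the later passage to the limit.\<close>

lemma tendsto_correlation:
  fixes f g :: "real \<Rightarrow> complex" and z :: "nat \<Rightarrow> real"
  assumes f: "integrable lborel f" and g: "g \<in> borel_measurable borel"
    and M: "AE x in lborel. cmod (g x) \<le> M" and z: "z \<longlonglongrightarrow> 0"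
  shows "cmod (LINT y|lborel. f (y + a) * g y) \<le> M * (LINT y|lborel. cmod (f y))"
    and "(\<lambda>n. LINT y|lborel. f (y + z n) * g y) \<longlonglongrightarrow> (LINT y|lborel. f y * g y)"
proof -
  have [measurable]: "f \<in> borel_measurable borel" "g \<in> borel_measurable borel" using f g by auto
  have int: "integrable lborel (\<lambda>y. h y * g y)" if h: "integrable lborel h" for h
  proof (rule Bochner_Integration.integrable_bound)
    show "integrable lborel (\<lambda>y. cmod (h y) * M)" using h by simp
    have [measurable]: "h \<in> borel_measurable borel" using h by auto
    show "(\<lambda>y. h y * g y) \<in> borel_measurable lborel" by measurable
    show "AE y in lborel. norm (h y * g y) \<le> norm (cmod (h y) * M)"
      using M by eventually_elim (auto simp: norm_mult abs_mult intro!: mult_left_mono)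
  qed
  have bd: "cmod (LINT y|lborel. h y * g y) \<le> M * (LINT y|lborel. cmod (h y))" if h: "integrable lborel h" for h
  proof -
    have "cmod (LINT y|lborel. h y * g y) \<le> (LINT y|lborel. cmod (h y * g y))" by (rule integral_norm_bound)
    also have "\<dots> \<le> (LINT y|lborel. M * cmod (h y))"
    proof (rule integral_mono_AE)
      show "AE y in lborel. cmod (h y * g y) \<le> M * cmod (h y)"
        using M by eventually_elim (auto simp: norm_mult mult.commute[of M] intro!: mult_left_mono)
    qed (use h int in auto)
    finally show ?thesis by simp
  qed
  note sh = integral_norm_shift_diff_le(2)[OF f]
  show "cmod (LINT y|lborel. f (y + a) * g y) \<le> M * (LINT y|lborel. cmod (f y))"
    using bd[OF sh, of a] integral_shift[of "\<lambda>y. cmod (f y)" a] by simp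
  show "(\<lambda>n. LINT y|lborel. f (y + z n) * g y) \<longlonglongrightarrow> (LINT y|lborel. f y * g y)"
  proof (rule Lim_null[THEN iffD2], rule Lim_null_comparison)
    show "(\<lambda>n. M * (LINT y|lborel. norm (f (y + z n) - f y))) \<longlonglongrightarrow> 0"
      using tendsto_mult_left[OF translation_L1[OF f z], of M] by simp
    show "\<forall>\<^sub>F n in sequentially. norm ((LINT y|lborel. f (y + z n) * g y) - (LINT y|lborel. f y * g y))
      \<le> M * (LINT y|lborel. norm (f (y + z n) - f y))"
    proof (rule always_eventually, rule allI)
      fix n
      have "(LINT y|lborel. f (y + z n) * g y) - (LINT y|lborel. f y * g y) = (LINT y|lborel. (f (y + z n) - f y) * g y)"
        using int[OF f] int[OF sh[of "z n"]] by (simp add: left_diff_distrib)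
      also have "norm \<dots> \<le> M * (LINT y|lborel. norm (f (y + z n) - f y))"
        by (rule bd) (use f sh in auto)
      finally show "norm ((LINT y|lborel. f (y + z n) * g y) - (LINT y|lborel. f y * g y)) \<le> \<dots>" .
    qed
  qed
qed

text \<open>Let \<epsilon> = 1 / (n + 1) tend to 0 in \<open>smoothed_parseval\<close>. Dominated
  convergence applies on the frequency side because \<open>Plancherel_le\<close> puts both
  transforms in \<open>L2\<close>, and on the other side because the correlation is bounded and
  continuous at 0.\<close>

lemma Parseval_L1_L2:
  fixes f g :: "real \<Rightarrow> complex"
  assumes f: "integrable lborel f" "f \<in> L2" and g: "integrable lborel g" "g \<in> L2"
    and M: "AE x in lborel. cmod (g x) \<le> M"
  shows "(LINT \<xi>|lborel. FT f \<xi> * FT g (- \<xi>)) = 2 * pi * (LINT x|lborel. f x * g x)"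
proof (rule LIMSEQ_unique)
  have [measurable]: "f \<in> borel_measurable borel" "g \<in> borel_measurable borel" using f g by auto
  define S where "S n = (LINT \<xi>|lborel. FT f \<xi> * FT g (- \<xi>) * of_real (exp (- (1 / real (Suc n) * \<xi>)\<^sup>2 / 2)))" for n
  have i: "integrable lborel (\<lambda>\<xi>. FT f \<xi> * FT g (- \<xi>))"
    by (intro integrable_L2_mult L2_reflect FT_in_L2 f g)
  show "S \<longlonglongrightarrow> (LINT \<xi>|lborel. FT f \<xi> * FT g (- \<xi>))"
    unfolding S_def
  proof (rule integral_dominated_convergence[where w="\<lambda>\<xi>. norm (FT f \<xi> * FT g (- \<xi>))"])
    show "AE \<xi> in lborel. (\<lambda>n. FT f \<xi> * FT g (- \<xi>) * of_real (exp (- (1 / real (Suc n) * \<xi>)\<^sup>2 / 2))) \<longlonglongrightarrow> FT f \<xi> * FT g (- \<xi>)"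
    proof (rule AE_I2)
      fix \<xi>
      show "(\<lambda>n. FT f \<xi> * FT g (- \<xi>) * of_real (exp (- (1 / real (Suc n) * \<xi>)\<^sup>2 / 2))) \<longlonglongrightarrow> FT f \<xi> * FT g (- \<xi>)"
        using tendsto_mult_left[OF tendsto_of_real[OF tendsto_gaussian_weight[of \<xi>]], of "FT f \<xi> * FT g (- \<xi>)"]
        by simp
    qed
    show "AE \<xi> in lborel. norm (FT f \<xi> * FT g (- \<xi>) * of_real (exp (- (1 / real (Suc n) * \<xi>)\<^sup>2 / 2))) \<le> norm (FT f \<xi> * FT g (- \<xi>))" for n
    proof (rule AE_I2)
      fix \<xi>
      show "norm (FT f \<xi> * FT g (- \<xi>) * of_real (exp (- (1 / real (Suc n) * \<xi>)\<^sup>2 / 2))) \<le> norm (FT f \<xi> * FT g (- \<xi>))"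
        unfolding norm_mult[of "FT f \<xi> * FT g (- \<xi>)"] norm_of_real by (intro mult_left_le) auto
    qed
  qed (use i in \<open>auto intro: integrable_norm\<close>)
  have z: "(\<lambda>n. 1 / real (Suc n) * s) \<longlonglongrightarrow> 0" for s
    using tendsto_mult_right[OF LIMSEQ_inverse_real_of_nat, of s] by (simp add: inverse_eq_divide)
  define A where "A = (\<lambda>a. LINT y|lborel. f (y + a) * g y)"
  have [measurable]: "A \<in> borel_measurable borel" unfolding A_def by measurable
  have A_bd: "cmod (A a) \<le> M * (LINT y|lborel. cmod (f y))" for a
    unfolding A_def by (rule tendsto_correlation(1)[OF f(1) _ M z[of 0]]) simp
  have "(\<lambda>n. LINT s|lborel. of_real (std_normal_density s) * A (1 / real (Suc n) * s))
    \<longlonglongrightarrow> (LINT s|lborel. of_real (std_normal_density s) * A 0)"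
  proof (rule integral_dominated_convergence[where w="\<lambda>s. std_normal_density s * (M * (LINT y|lborel. cmod (f y)))"])
    show "AE s in lborel. (\<lambda>n. of_real (std_normal_density s) * A (1 / real (Suc n) * s)) \<longlonglongrightarrow> of_real (std_normal_density s) * A 0"
    proof (rule AE_I2)
      fix s
      have "(\<lambda>n. A (1 / real (Suc n) * s)) \<longlonglongrightarrow> A 0"
        unfolding A_def using tendsto_correlation(2)[OF f(1) _ M z[of s]] by simp
      then show "(\<lambda>n. of_real (std_normal_density s) * A (1 / real (Suc n) * s)) \<longlonglongrightarrow> of_real (std_normal_density s) * A 0"
        by (rule tendsto_mult_left)
    qed
    show "AE s in lborel. norm (of_real (std_normal_density s) * A (1 / real (Suc n) * s)) \<le> std_normal_density s * (M * (LINT y|lborel. cmod (f y)))" for n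
    proof (rule AE_I2)
      fix s
      show "norm (of_real (std_normal_density s) * A (1 / real (Suc n) * s)) \<le> std_normal_density s * (M * (LINT y|lborel. cmod (f y)))"
        unfolding norm_mult norm_of_real abs_of_nonneg[OF normal_density_nonneg]
        by (intro mult_left_mono A_bd) (simp add: normal_density_nonneg)
    qed
  qed auto
  also have "(LINT s|lborel. of_real (std_normal_density s) * A 0) = A 0"
  proof -
    have "(LINT s|lborel. complex_of_real (std_normal_density s)) = of_real (LINT s|lborel. std_normal_density s)"
      by (rule integral_complex_of_real)
    then show ?thesis by simp
  qed
  finally have "(\<lambda>n. 2 * pi * (LINT s|lborel. of_real (std_normal_density s) * A (1 / real (Suc n) * s))) \<longlonglongrightarrow> 2 * pi * A 0"
    by (rule tendsto_mult_left)
  moreover have "S = (\<lambda>n. 2 * pi * (LINT s|lborel. of_real (std_normal_density s) * A (1 / real (Suc n) * s)))"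
    unfolding S_def A_def by (rule ext, rule smoothed_parseval[OF f(1) g(1)]) simp
  moreover have "A 0 = (LINT x|lborel. f x * g x)" unfolding A_def by simp
  ultimately show "S \<longlonglongrightarrow> 2 * pi * (LINT x|lborel. f x * g x)" by (simp only:)
qed

text \<open>The bounded function \<open>g\<close> stays fixed with its pointwise transform, while
  \<open>u\<close> is approximated by truncations; both sides are continuous in \<open>u\<close> for
  the L2 norm.\<close>

lemma Parseval:
  fixes u g :: "real \<Rightarrow> complex"
  assumes u: "u \<in> L2" and g: "integrable lborel g" "g \<in> L2"
    and M: "AE x in lborel. cmod (g x) \<le> M"
  shows "(LINT \<xi>|lborel. fourier u \<xi> * FT g (- \<xi>)) = 2 * pi * (LINT x|lborel. u x * g x)"
proof -
  have h: "(\<lambda>\<xi>. FT g (- \<xi>)) \<in> L2" by (intro L2_reflect FT_in_L2 g)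
  have 1: "((\<lambda>R. LINT \<xi>|lborel. FT g (- \<xi>) * FT (trunc R u) \<xi>) \<longlongrightarrow> (LINT \<xi>|lborel. FT g (- \<xi>) * fourier u \<xi>)) at_top"
    by (rule tendsto_L2_mult[OF h fourier_spec(1)[OF u] _ fourier_spec(2)[OF u]])
      (intro FT_in_L2 trunc_integrable trunc_L2 u)
  have 2: "((\<lambda>R. LINT x|lborel. g x * trunc R u x) \<longlongrightarrow> (LINT x|lborel. g x * u x)) at_top"
    by (rule tendsto_L2_mult[OF g(2) u trunc_L2[OF u] trunc_tendsto[OF u]])
  have "(LINT \<xi>|lborel. FT g (- \<xi>) * FT (trunc R u) \<xi>) = 2 * pi * (LINT x|lborel. g x * trunc R u x)" for R
    using Parseval_L1_L2[OF trunc_integrable[OF u] trunc_L2[OF u] g M, of R] by (simp add: mult.commute)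
  with 1 have "((\<lambda>R. 2 * pi * (LINT x|lborel. g x * trunc R u x)) \<longlongrightarrow> (LINT \<xi>|lborel. FT g (- \<xi>) * fourier u \<xi>)) at_top"
    by simp
  from tendsto_unique[OF _ this tendsto_mult_left[OF 2]]
  show ?thesis by (simp add: mult.commute)
qed

text \<open>A weak description of \<open>inv_fourier\<close>: for truncated \<open>G\<close> the
  identity is \<open>FT_exchange\<close>, and both sides pass to the limit as pairings with fixed L2
  functions.\<close>

lemma integral_mult_inv_fourier:
  fixes f G :: "real \<Rightarrow> complex"
  assumes f: "integrable lborel f" "f \<in> L2" and G: "G \<in> L2"
  shows "(LINT x|lborel. f x * inv_fourier G x) = 1 / (2 * of_real pi) * (LINT \<xi>|lborel. G \<xi> * FT f (- \<xi>))"
proof -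
  let ?c = "1 / (2 * complex_of_real pi)"
  note t = trunc_integrable[OF G] trunc_L2[OF G]
  have 1: "((\<lambda>R. LINT x|lborel. f x * (?c * FT (trunc R G) (- x))) \<longlongrightarrow> (LINT x|lborel. f x * inv_fourier G x)) at_top"
    by (rule tendsto_L2_mult[OF f(2) inv_fourier_spec(1)[OF G] _ inv_fourier_spec(2)[OF G]])
      (intro L2_cmult L2_reflect FT_in_L2 t)
  have h: "(\<lambda>\<xi>. FT f (- \<xi>)) \<in> L2" by (intro L2_reflect FT_in_L2 f)
  have 2: "((\<lambda>R. LINT \<xi>|lborel. FT f (- \<xi>) * trunc R G \<xi>) \<longlongrightarrow> (LINT \<xi>|lborel. FT f (- \<xi>) * G \<xi>)) at_top"
    by (rule tendsto_L2_mult[OF h G t(2) trunc_tendsto[OF G]])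
  have "(LINT x|lborel. f x * (?c * FT (trunc R G) (- x))) = ?c * (LINT \<xi>|lborel. FT f (- \<xi>) * trunc R G \<xi>)" for R
  proof -
    have "(LINT x|lborel. f x * (?c * FT (trunc R G) (- x))) = (LINT x|lborel. ?c * (f x * FT (trunc R G) (- x)))"
      by (intro Bochner_Integration.integral_cong) auto
    also have "\<dots> = ?c * (LINT x|lborel. f x * FT (trunc R G) (- x))" by (rule integral_mult_right_zero)
    also have "(LINT x|lborel. f x * FT (trunc R G) (- x)) = (LINT \<xi>|lborel. FT f (- \<xi>) * trunc R G \<xi>)"
      using FT_exchange[OF f(1) t(1), of R] by (simp add: mult.commute)
    finally show ?thesis .
  qed
  with 1 have "((\<lambda>R. ?c * (LINT \<xi>|lborel. FT f (- \<xi>) * trunc R G \<xi>)) \<longlongrightarrow> (LINT x|lborel. f x * inv_fourier G x)) at_top"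
    by simp
  from tendsto_unique[OF _ this tendsto_mult_left[OF 2]]
  show ?thesis by (simp add: mult.commute)
qed

section \<open>Consequences of Sobolev regularity\<close>

text \<open>Writing \<open>fourier U\<close> as (1 + \<xi>^2)^(-1) times \<open>W\<close> exhibits
  it as a product of two L2 functions, hence integrable. The weighted claim follows from
  |\<xi>|^\<beta> \<le> 1 + \<xi>^2.\<close>

lemma sobolev_2D:
  assumes U: "U \<in> sobolev 2"
  shows "U \<in> L2" "integrable lborel (fourier U)"
    and "\<lbrakk>0 \<le> \<beta>; \<beta> \<le> 2\<rbrakk> \<Longrightarrow> (\<lambda>\<xi>. of_real (\<bar>\<xi>\<bar> powr \<beta>) * fourier U \<xi>) \<in> L2"
proof -
  show UL: "U \<in> L2" using U by (simp add: sobolev_def)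
  have F [measurable]: "fourier U \<in> borel_measurable borel" using fourier_spec(1)[OF UL] by auto
  define W where "W \<xi> = of_real (1 + \<xi>\<^sup>2) * fourier U \<xi>" for \<xi>
  have pos: "1 + \<xi>\<^sup>2 > 0" for \<xi> :: real by (rule add_pos_nonneg) auto
  have "W = (\<lambda>\<xi>. of_real ((1 + \<xi>\<^sup>2) powr (2 / 2)) * fourier U \<xi>)"
    unfolding W_def using pos by (intro ext) (simp add: less_imp_le)
  then have W: "W \<in> L2" using U by (simp add: sobolev_def)
  have inv: "(\<lambda>\<xi>::real. complex_of_real (inverse (1 + \<xi>\<^sup>2))) \<in> L2"
    unfolding L2_def
  proof safe
    show "integrable lborel (\<lambda>\<xi>. (cmod (complex_of_real (inverse (1 + \<xi>\<^sup>2))))\<^sup>2)"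
    proof (rule Bochner_Integration.integrable_bound)
      show "integrable lborel (\<lambda>\<xi>::real. inverse (1 + \<xi>\<^sup>2))"
        using integrable_inverse_1_plus_square by (simp add: set_integrable_def)
      show "AE \<xi> in lborel. norm ((cmod (complex_of_real (inverse (1 + \<xi>\<^sup>2))))\<^sup>2) \<le> norm (inverse (1 + \<xi>\<^sup>2))"
      proof (rule AE_I2)
        fix \<xi> :: real
        have "inverse (1 + \<xi>\<^sup>2) \<le> 1" "inverse (1 + \<xi>\<^sup>2) \<ge> 0" using pos[of \<xi>] by (auto simp: inverse_le_1_iff)
        then show "norm ((cmod (complex_of_real (inverse (1 + \<xi>\<^sup>2))))\<^sup>2) \<le> norm (inverse (1 + \<xi>\<^sup>2))"
          unfolding norm_of_real by (simp add: power2_eq_square mult_left_le)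
      qed
    qed measurable
  qed measurable
  have "integrable lborel (\<lambda>\<xi>. complex_of_real (inverse (1 + \<xi>\<^sup>2)) * W \<xi>)"
    by (rule integrable_L2_mult[OF inv W])
  also have "(\<lambda>\<xi>. complex_of_real (inverse (1 + \<xi>\<^sup>2)) * W \<xi>) = fourier U"
  proof
    fix \<xi>
    have "complex_of_real (inverse (1 + \<xi>\<^sup>2)) * W \<xi> = of_real (inverse (1 + \<xi>\<^sup>2) * (1 + \<xi>\<^sup>2)) * fourier U \<xi>"
      unfolding W_def of_real_mult by (simp only: mult.assoc)
    also have "inverse (1 + \<xi>\<^sup>2) * (1 + \<xi>\<^sup>2) = 1" using pos[of \<xi>] by simp
    finally show "complex_of_real (inverse (1 + \<xi>\<^sup>2)) * W \<xi> = fourier U \<xi>" by simp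
  qed
  finally show "integrable lborel (fourier U)" .
  assume b: "0 \<le> \<beta>" "\<beta> \<le> 2"
  show "(\<lambda>\<xi>. of_real (\<bar>\<xi>\<bar> powr \<beta>) * fourier U \<xi>) \<in> L2"
  proof (rule L2_bound[OF W, where B=1])
    have le: "\<bar>\<xi>\<bar> powr \<beta> \<le> 1 + \<xi>\<^sup>2" for \<xi> :: real
    proof (cases "\<bar>\<xi>\<bar> \<le> 1")
      case True
      then have "\<bar>\<xi>\<bar> powr \<beta> \<le> 1 powr \<beta>" using b by (intro powr_mono2) auto
      then show ?thesis unfolding powr_one_eq_one using zero_le_power2[of \<xi>] by linarith
    next
      case False
      then have "\<bar>\<xi>\<bar> powr \<beta> \<le> \<bar>\<xi>\<bar> powr 2" using b by (intro powr_mono) auto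
      also have "\<dots> = \<xi>\<^sup>2" using False by (simp add: powr_numeral)
      finally show ?thesis by simp
    qed
    show "AE \<xi> in lborel. cmod (of_real (\<bar>\<xi>\<bar> powr \<beta>) * fourier U \<xi>) \<le> 1 * cmod (W \<xi>)"
    proof (rule AE_I2)
      fix \<xi>
      show "cmod (of_real (\<bar>\<xi>\<bar> powr \<beta>) * fourier U \<xi>) \<le> 1 * cmod (W \<xi>)"
        unfolding W_def norm_mult norm_of_real abs_of_pos[OF pos] abs_of_nonneg[OF powr_ge_zero] mult_1_left
        by (intro mult_right_mono le) auto
    qed
  qed measurable
qed

text \<open>Duality. On a bounded piece \<open>B\<close> of the set where |u| exceeds
  \<open>M\<close>, testing \<open>u\<close> against its sign shows by Parseval that the integral of
  |u| over \<open>B\<close> is at most \<open>M\<close> times the measure of \<open>B\<close>. As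
  |u| > M on \<open>B\<close>, this set is null. The bound \<open>M\<close> is the L1 norm of the
  transform divided by 2 pi.\<close>

lemma AE_bounded_if_integrable_fourier:
  fixes u :: "real \<Rightarrow> real"
  assumes U: "(\<lambda>x. complex_of_real (u x)) \<in> L2" and i: "integrable lborel (fourier (\<lambda>x. complex_of_real (u x)))"
  obtains M where "M \<ge> 0" "AE x in lborel. \<bar>u x\<bar> \<le> M"
proof -
  let ?U = "\<lambda>x. complex_of_real (u x)"
  define M where "M = (LINT \<xi>|lborel. cmod (fourier ?U \<xi>)) / (2 * pi)"
  have "(\<lambda>x. Re (?U x)) \<in> borel_measurable borel" using U by measurable
  then have um [measurable]: "u \<in> borel_measurable borel" by simp
  have "AE x in lborel. \<not> (\<bar>x\<bar> \<le> real n \<and> \<bar>u x\<bar> > M)" for n :: nat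
  proof -
    \<comment> \<open>The cutoff at \<open>n\<close> makes the measure of \<open>B\<close> finite,
      so that the test function lies in L1 and in L2.\<close>
    define B where "B = {x. \<bar>x\<bar> \<le> real n \<and> \<bar>u x\<bar> > M}"
    have [measurable]: "B \<in> sets borel" unfolding B_def by measurable
    have fin: "emeasure lborel B < \<infinity>"
    proof (rule order.strict_trans1[OF emeasure_mono])
      show "B \<subseteq> {- real n..real n}" by (auto simp: B_def)
    qed (auto simp: emeasure_lborel_Icc_eq)
    have iB: "integrable lborel (indicat_real B)" using fin by (intro integrable_real_indicator) auto
    define f where "f x = complex_of_real (sgn (u x) * indicator B x)" for x
    have fm [measurable]: "f \<in> borel_measurable borel" unfolding f_def by measurable
    have f_le: "cmod (f x) \<le> indicator B x" for x by (auto simp: f_def indicator_def abs_sgn_eq)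
    have f_le1: "cmod (f x) \<le> 1" for x using f_le[of x] by (cases "x \<in> B") auto
    have fi: "integrable lborel f"
      by (rule Bochner_Integration.integrable_bound[OF iB]) (use f_le in auto)
    have "f \<in> L2" unfolding L2_def
    proof safe
      show "integrable lborel (\<lambda>x. (cmod (f x))\<^sup>2)"
      proof (rule Bochner_Integration.integrable_bound[OF iB])
        show "AE x in lborel. norm ((cmod (f x))\<^sup>2) \<le> norm (indicat_real B x)"
          using f_le power_le_one[OF norm_ge_zero f_le1] by (intro AE_I2) (auto simp: f_def indicator_def)
      qed measurable
    qed measurable
    from Parseval[OF U fi this, of 1] f_le1
    have P: "(LINT \<xi>|lborel. fourier ?U \<xi> * FT f (- \<xi>)) = 2 * pi * (LINT x|lborel. ?U x * f x)" by simp
    have iu: "integrable lborel (\<lambda>x. ?U x * f x)" by (rule integrable_L2_mult[OF U \<open>f \<in> L2\<close>])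
    have Uf: "?U x * f x = of_real (\<bar>u x\<bar> * indicator B x)" for x
      by (simp add: f_def abs_sgn mult.assoc)
    have iu': "integrable lborel (\<lambda>x. \<bar>u x\<bar> * indicator B x)"
      using integrable_Re[OF iu] unfolding Uf by (simp only: Re_complex_of_real)
    have "2 * pi * (LINT x|lborel. \<bar>u x\<bar> * indicator B x) = cmod (2 * pi * (LINT x|lborel. ?U x * f x))"
      unfolding Uf integral_complex_of_real by (simp add: norm_mult)
    also have "\<dots> = cmod (LINT \<xi>|lborel. fourier ?U \<xi> * FT f (- \<xi>))" unfolding P ..
    also have "\<dots> \<le> (LINT \<xi>|lborel. cmod (fourier ?U \<xi> * FT f (- \<xi>)))" by (rule integral_norm_bound)
    also have "\<dots> \<le> (LINT \<xi>|lborel. cmod (fourier ?U \<xi>) * measure lborel B)"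
    proof (rule integral_mono)
      have "(LINT x|lborel. cmod (f x)) \<le> (LINT x|lborel. indicator B x)"
        using fi iB f_le by (intro integral_mono) auto
      then have FTle: "cmod (FT f (- \<xi>)) \<le> measure lborel B" for \<xi>
        using norm_FT_le[OF fi, of "- \<xi>"] by simp
      have Fm: "fourier ?U \<in> borel_measurable borel" using i by auto
      show "integrable lborel (\<lambda>\<xi>. cmod (fourier ?U \<xi>) * measure lborel B)" using i by simp
      then show "integrable lborel (\<lambda>\<xi>. cmod (fourier ?U \<xi> * FT f (- \<xi>)))"
      proof (rule Bochner_Integration.integrable_bound)
        show "(\<lambda>\<xi>. cmod (fourier ?U \<xi> * FT f (- \<xi>))) \<in> borel_measurable lborel" using Fm by measurable
        show "AE \<xi> in lborel. norm (cmod (fourier ?U \<xi> * FT f (- \<xi>))) \<le> norm (cmod (fourier ?U \<xi>) * measure lborel B)"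
          by (rule AE_I2) (simp add: norm_mult mult_left_mono FTle)
      qed
      show "cmod (fourier ?U \<xi> * FT f (- \<xi>)) \<le> cmod (fourier ?U \<xi>) * measure lborel B" for \<xi>
        by (simp add: norm_mult mult_left_mono FTle)
    qed
    also have "\<dots> = 2 * pi * (M * measure lborel B)" by (simp add: M_def)
    finally have "(LINT x|lborel. \<bar>u x\<bar> * indicator B x) \<le> M * measure lborel B" by simp
    then have le0: "(LINT x|lborel. (\<bar>u x\<bar> - M) * indicator B x) \<le> 0"
      using iu' iB by (simp add: left_diff_distrib)
    have nn: "AE x in lborel. 0 \<le> (\<bar>u x\<bar> - M) * indicator B x" by (rule AE_I2) (auto simp: B_def indicator_def)
    have ii: "integrable lborel (\<lambda>x. (\<bar>u x\<bar> - M) * indicator B x)" using iu' iB by (simp add: left_diff_distrib)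
    have "(LINT x|lborel. (\<bar>u x\<bar> - M) * indicator B x) = 0"
      using le0 integral_nonneg_AE[OF nn] by simp
    then have "AE x in lborel. (\<bar>u x\<bar> - M) * indicator B x = 0"
      using integral_nonneg_eq_0_iff_AE[OF ii nn] by simp
    then show ?thesis by eventually_elim (auto simp: B_def indicator_def split: if_splits)
  qed
  then have "AE x in lborel. \<forall>n::nat. \<not> (\<bar>x\<bar> \<le> real n \<and> \<bar>u x\<bar> > M)" by (subst AE_all_countable) blast
  then have "AE x in lborel. \<bar>u x\<bar> \<le> M"
  proof eventually_elim
    case (elim x)
    then show ?case using real_arch_simple[of "\<bar>x\<bar>"] by (auto simp: not_less)
  qed
  moreover have "M \<ge> 0" by (simp add: M_def)
  ultimately show thesis by (intro that)
qed

text \<open>With the cosine expanded into exponentials, each exponential times \<open>FT f\<close>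
  is the transform of a translate of \<open>f\<close>, and Parseval applies term by term.\<close>

lemma fourier_increment:
  fixes U f :: "real \<Rightarrow> complex"
  assumes U: "U \<in> L2" and f: "integrable lborel f" "f \<in> L2" and M: "AE x in lborel. cmod (f x) \<le> M"
  shows "(LINT \<xi>|lborel. fourier U \<xi> * FT f (- \<xi>) * of_real (1 - cos (\<xi> * y)))
    = pi * (LINT x|lborel. (f (x + y) - f x) * (U (x + y) - U x))"
proof -
  have [measurable]: "f \<in> borel_measurable borel" using f by auto
  have P: "(LINT \<xi>|lborel. fourier U \<xi> * FT (\<lambda>x. f (x + a)) (- \<xi>)) = 2 * pi * (LINT x|lborel. U x * f (x + a))" for a
  proof (rule Parseval[OF U integral_norm_shift_diff_le(2)[OF f(1)] L2_shift[OF f(2)]])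
    have "AE x in lborel. cmod (f (a + 1 * x)) \<le> M" by (rule AE_borel_affine) (use M in auto)
    then show "AE x in lborel. cmod (f (x + a)) \<le> M" by (simp add: add.commute)
  qed
  have i: "integrable lborel (\<lambda>\<xi>. fourier U \<xi> * FT (\<lambda>x. f (x + a)) (- \<xi>))" for a
    by (intro integrable_L2_mult fourier_spec U L2_reflect FT_in_L2 L2_shift f integral_norm_shift_diff_le(2))
  have "fourier U \<xi> * FT f (- \<xi>) * of_real (1 - cos (\<xi> * y))
    = fourier U \<xi> * FT (\<lambda>x. f (x + 0)) (- \<xi>)
      - 1 / 2 * (fourier U \<xi> * FT (\<lambda>x. f (x + y)) (- \<xi>)) - 1 / 2 * (fourier U \<xi> * FT (\<lambda>x. f (x + (- y))) (- \<xi>))" for \<xi>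
  proof -
    have "complex_of_real (cos (\<xi> * y)) = (exp (\<i> * of_real (y * \<xi>)) + exp (- (\<i> * of_real (y * \<xi>)))) / 2"
      by (simp add: cos_of_real[symmetric] cos_exp_eq mult.commute)
    moreover have "FT (\<lambda>x. f (x + y)) (- \<xi>) = exp (- (\<i> * of_real (y * \<xi>))) * FT f (- \<xi>)"
      using FT_shift[of f "- y" "- \<xi>"] by simp
    moreover have "FT (\<lambda>x. f (x + (- y))) (- \<xi>) = exp (\<i> * of_real (y * \<xi>)) * FT f (- \<xi>)"
      using FT_shift[of f "y" "- \<xi>"] by simp
    ultimately show ?thesis
      by (simp only: of_real_diff of_real_1) (simp add: algebra_simps add_divide_distrib)
  qed
  then have "(LINT \<xi>|lborel. fourier U \<xi> * FT f (- \<xi>) * of_real (1 - cos (\<xi> * y)))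
    = (LINT \<xi>|lborel. fourier U \<xi> * FT (\<lambda>x. f (x + 0)) (- \<xi>)
      - 1 / 2 * (fourier U \<xi> * FT (\<lambda>x. f (x + y)) (- \<xi>)) - 1 / 2 * (fourier U \<xi> * FT (\<lambda>x. f (x + (- y))) (- \<xi>)))"
    by presburger
  also have "\<dots> = (LINT \<xi>|lborel. fourier U \<xi> * FT (\<lambda>x. f (x + 0)) (- \<xi>))
      - 1 / 2 * (LINT \<xi>|lborel. fourier U \<xi> * FT (\<lambda>x. f (x + y)) (- \<xi>))
      - 1 / 2 * (LINT \<xi>|lborel. fourier U \<xi> * FT (\<lambda>x. f (x + (- y))) (- \<xi>))"
    using i[of 0] i[of y] i[of "- y"]
    by (subst Bochner_Integration.integral_diff Bochner_Integration.integral_diff, (simp; fail), (simp; fail))+ simp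
  also have "\<dots> = pi * (2 * (LINT x|lborel. U x * f x) - (LINT x|lborel. U x * f (x + y)) - (LINT x|lborel. U x * f (x + (- y))))"
    unfolding P by (simp add: field_simps)
  also have "(LINT x|lborel. U x * f (x + (- y))) = (LINT x|lborel. U (x + y) * f x)"
    using integral_shift[of "\<lambda>x. U x * f (x + (- y))" y] by simp
  \<comment> \<open>One of the two copies of the integral of \<open>U * f\<close> is shifted by
    \<open>y\<close>, so that the four terms factor into a product of increments.\<close>
  also have "2 * (LINT x|lborel. U x * f x) - (LINT x|lborel. U x * f (x + y)) - (LINT x|lborel. U (x + y) * f x)
     = (LINT x|lborel. U (x + y) * f (x + y)) - (LINT x|lborel. U x * f (x + y)) - ((LINT x|lborel. U (x + y) * f x) - (LINT x|lborel. U x * f x))"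
    using integral_shift[of "\<lambda>x. U x * f x" y] by simp
  also have "\<dots> = (LINT x|lborel. (U (x + y) * f (x + y) - U x * f (x + y)) - (U (x + y) * f x - U x * f x))"
  proof -
    have j: "integrable lborel (\<lambda>x. U (x + a) * f (x + b))" for a b by (intro integrable_L2_mult L2_shift U f)
    show ?thesis using j[of y y] j[of 0 y] j[of y 0] j[of 0 0] by simp
  qed
  also have "\<dots> = (LINT x|lborel. (f (x + y) - f x) * (U (x + y) - U x))"
    by (intro Bochner_Integration.integral_cong) (auto simp: algebra_simps)
  finally show ?thesis .
qed

section \<open>Increments and the cosine kernel\<close>

text \<open>The left side is at most (m + 1)^2 M^(2 m) (b - a)^2 with \<open>M\<close> the larger
  modulus, and M^(2 m) is at most p + q. On the right, the product equals half of (p + q) (b - a)^2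
  plus half of (p - q) (b^2 - a^2); the last term is nonnegative since \<open>p\<close> and
  \<open>q\<close> are the same increasing function of b^2 and a^2.\<close>

lemma square_power_diff_le:
  fixes a b :: real
  shows "(b ^ (m + 1) - a ^ (m + 1))\<^sup>2 \<le> 2 * (real m + 1)\<^sup>2 * ((b ^ (2 * m + 1) - a ^ (2 * m + 1)) * (b - a))"
proof -
  define M where "M = max \<bar>a\<bar> \<bar>b\<bar>"
  have M0: "M \<ge> 0" by (simp add: M_def)
  have pM: "\<bar>a\<bar> ^ n \<le> M ^ n" for n by (rule power_mono) (auto simp: M_def)
  have lin: "\<bar>b ^ (n + 1) - a ^ (n + 1)\<bar> \<le> (real n + 1) * M ^ n * \<bar>b - a\<bar>" for n
  proof (induction n)
    case (Suc n)
    have "\<bar>b ^ (Suc n + 1) - a ^ (Suc n + 1)\<bar> = \<bar>b * (b ^ (n + 1) - a ^ (n + 1)) + (b - a) * a ^ Suc n\<bar>"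
      by (simp add: algebra_simps)
    also have "\<dots> \<le> \<bar>b\<bar> * \<bar>b ^ (n + 1) - a ^ (n + 1)\<bar> + \<bar>b - a\<bar> * \<bar>a\<bar> ^ Suc n"
      by (rule order_trans[OF abs_triangle_ineq]) (simp only: abs_mult power_abs order_refl)
    also have "\<dots> \<le> M * ((real n + 1) * M ^ n * \<bar>b - a\<bar>) + \<bar>b - a\<bar> * M ^ Suc n"
      by (intro add_mono mult_mono Suc pM) (auto simp: M_def)
    also have "\<dots> = (real (Suc n) + 1) * M ^ Suc n * \<bar>b - a\<bar>" by (simp add: algebra_simps)
    finally show ?case .
  qed simp
  define p q where "p = b ^ (2 * m)" and "q = a ^ (2 * m)"
  have pq: "p \<ge> 0" "q \<ge> 0" by (simp_all add: p_def q_def power_mult)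
  have "M ^ (2 * m) \<le> p + q"
    using pq by (auto simp: M_def max_def p_def q_def power_even_abs)
  have mono: "(p - q) * (b\<^sup>2 - a\<^sup>2) \<ge> 0"
  proof (cases "a\<^sup>2 \<le> b\<^sup>2")
    case True
    then have "q \<le> p" unfolding p_def q_def power_mult by (rule power_mono) auto
    with True show ?thesis by (intro mult_nonneg_nonneg) auto
  next
    case False
    have "p \<le> q" unfolding p_def q_def power_mult by (rule power_mono) (use False in auto)
    with False show ?thesis by (intro mult_nonpos_nonpos) auto
  qed
  have "(b ^ (2 * m + 1) - a ^ (2 * m + 1)) * (b - a) = (b * p - a * q) * (b - a)"
    by (simp add: p_def q_def)
  also have "\<dots> = 1 / 2 * (p + q) * (b - a)\<^sup>2 + 1 / 2 * ((p - q) * (b\<^sup>2 - a\<^sup>2))"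
    by (simp add: power2_eq_square field_simps)
  finally have key: "(p + q) * (b - a)\<^sup>2 \<le> 2 * ((b ^ (2 * m + 1) - a ^ (2 * m + 1)) * (b - a))"
    using mono by simp
  have "(b ^ (m + 1) - a ^ (m + 1))\<^sup>2 \<le> ((real m + 1) * M ^ m * \<bar>b - a\<bar>)\<^sup>2"
    using power_mono[OF lin[of m] abs_ge_zero, of 2] by simp
  also have "\<dots> = (real m + 1)\<^sup>2 * (M ^ (2 * m) * (b - a)\<^sup>2)"
    by (simp add: power_mult_distrib power_mult[symmetric] mult.commute)
  also have "\<dots> \<le> (real m + 1)\<^sup>2 * ((p + q) * (b - a)\<^sup>2)"
    by (intro mult_left_mono mult_right_mono) (use \<open>M ^ (2 * m) \<le> p + q\<close> in auto)
  also have "\<dots> \<le> (real m + 1)\<^sup>2 * (2 * ((b ^ (2 * m + 1) - a ^ (2 * m + 1)) * (b - a)))"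
    by (intro mult_left_mono key) auto
  finally show ?thesis by (simp only: mult_ac)
qed

section \<open>Increments of square-integrable functions\<close>

lemma AE_shift:
  fixes P :: "real \<Rightarrow> bool"
  assumes "Measurable.pred borel P" "AE x in lborel. P x"
  shows "AE x in lborel. P (x + a)"
  using AE_borel_affine[of 1 P a] assms by (simp add: add.commute)

text \<open>By periodicity the mass of v^2 on [-R, R] equals its mass on every translate by
  \<open>n * y\<close>. These intervals escape to infinity, so integrability of v^2 forces the mass
  to be 0.\<close>

lemma L2_periodic_zero:
  fixes v :: "real \<Rightarrow> real"
  assumes [measurable]: "v \<in> borel_measurable borel" and v2: "integrable lborel (\<lambda>x. (v x)\<^sup>2)"
    and y: "y > 0" and per: "AE x in lborel. v (x + y) = v x"
  shows "AE x in lborel. v x = 0"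
proof -
  have pern: "AE x in lborel. v (x + real n * y) = v x" for n
  proof (induction n)
    case (Suc n)
    have "AE x in lborel. v (x + real n * y + y) = v (x + real n * y)"
      by (rule AE_shift[OF _ per]) measurable
    with Suc show ?case
    proof eventually_elim
      case (elim x)
      have "x + real (Suc n) * y = x + real n * y + y" by (simp add: algebra_simps)
      with elim show ?case by metis
    qed
  qed simp
  have zero: "AE x in lborel. (v x)\<^sup>2 * indicator {-R..R} x = 0" for R
  proof -
    define I where "I = (LINT x|lborel. (v x)\<^sup>2 * indicator {-R..R} x)"
    have iI: "integrable lborel (\<lambda>x. (v x)\<^sup>2 * indicator {-R..R} x)"
      using integrable_real_mult_indicator[OF _ v2, of "{-R..R}"] by (simp add: mult.commute)
    have Ieq: "I = (LINT x|lborel. (v x)\<^sup>2 * indicator {-R..R} (x - real n * y))" for n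
    proof -
      have "I = (LINT x|lborel. (v (x + real n * y))\<^sup>2 * indicator {-R..R} x)"
        unfolding I_def by (rule integral_cong_AE) (use pern[of n] in \<open>auto elim: eventually_mono\<close>)
      also have "\<dots> = (LINT x|lborel. (v x)\<^sup>2 * indicator {-R..R} (x - real n * y))"
        using integral_shift[of "\<lambda>x. (v x)\<^sup>2 * indicator {-R..R} (x - real n * y)" "real n * y"] by simp
      finally show ?thesis .
    qed
    have "(\<lambda>n. LINT x|lborel. (v x)\<^sup>2 * indicator {-R..R} (x - real n * y)) \<longlonglongrightarrow> (LINT x::real|lborel. 0)"
    proof (rule integral_dominated_convergence[OF _ _ v2])
      show "AE x in lborel. (\<lambda>n. (v x)\<^sup>2 * indicator {-R..R} (x - real n * y)) \<longlonglongrightarrow> 0"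
      proof (rule AE_I2)
        fix x
        obtain N where N: "\<bar>x\<bar> + \<bar>R\<bar> < real N * y"
          using reals_Archimedean3[OF y] by blast
        have "(v x)\<^sup>2 * indicator {-R..R} (x - real n * y) = 0" if "n \<ge> N" for n
        proof -
          have "real N * y \<le> real n * y" using that y by (intro mult_right_mono) auto
          with N show ?thesis by (auto simp: indicator_def)
        qed
        then show "(\<lambda>n. (v x)\<^sup>2 * indicator {-R..R} (x - real n * y)) \<longlonglongrightarrow> 0"
          by (intro tendsto_eventually) (auto simp: eventually_sequentially)
      qed
    qed (auto simp: indicator_def)
    then have "(\<lambda>n::nat. I) \<longlonglongrightarrow> 0" unfolding Ieq[symmetric] by simp
    then have "I = 0" by (simp add: LIMSEQ_const_iff)
    then show ?thesis
      unfolding I_def using integral_nonneg_eq_0_iff_AE[OF iI] by simp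
  qed
  have "AE x in lborel. \<forall>n::nat. (v x)\<^sup>2 * indicator {-real n..real n} x = 0"
    unfolding AE_all_countable using zero by blast
  then show ?thesis
  proof eventually_elim
    case (elim x)
    obtain n :: nat where "\<bar>x\<bar> \<le> real n" using real_arch_simple by blast
    then have "x \<in> {-real n..real n}" by auto
    then show ?case using spec[OF elim, of n] by simp
  qed
qed

text \<open>The path from x to x + n s is split into n steps. Cauchy-Schwarz on the telescoping sum
  costs one factor n, and the n step integrals, equal by translation invariance, give the
  other.\<close>

lemma integral_increment_le:
  fixes v :: "real \<Rightarrow> real"
  assumes [measurable]: "v \<in> borel_measurable borel" and v2: "integrable lborel (\<lambda>x. (v x)\<^sup>2)"
  shows "integrable lborel (\<lambda>x. (v (x + a) - v x)\<^sup>2)"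
    and "(LINT x|lborel. (v (x + real n * s) - v x)\<^sup>2) \<le> (real n)\<^sup>2 * (LINT x|lborel. (v (x + s) - v x)\<^sup>2)"
proof -
  show int: "integrable lborel (\<lambda>x. (v (x + a) - v x)\<^sup>2)" for a
  proof (rule Bochner_Integration.integrable_bound)
    show "integrable lborel (\<lambda>x. 2 * (v (x + a))\<^sup>2 + 2 * (v x)\<^sup>2)"
      using v2 integral_norm_shift_diff_le(2)[OF v2, of a] by simp
    show "AE x in lborel. norm ((v (x + a) - v x)\<^sup>2) \<le> norm (2 * (v (x + a))\<^sup>2 + 2 * (v x)\<^sup>2)"
    proof (rule AE_I2)
      fix x
      have "0 \<le> (v (x + a) + v x)\<^sup>2" by simp
      then have "(v (x + a) - v x)\<^sup>2 \<le> 2 * (v (x + a))\<^sup>2 + 2 * (v x)\<^sup>2"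
        by (simp add: power2_sum power2_diff)
      then show "norm ((v (x + a) - v x)\<^sup>2) \<le> norm (2 * (v (x + a))\<^sup>2 + 2 * (v x)\<^sup>2)"
        by (simp del: power2_abs)
    qed
  qed measurable
  let ?d = "\<lambda>i x. v (x + real i * s + s) - v (x + real i * s)"
  have shift: "(LINT x|lborel. (?d i x)\<^sup>2) = (LINT x|lborel. (v (x + s) - v x)\<^sup>2)" for i
    using integral_shift[of "\<lambda>x. (v (x + s) - v x)\<^sup>2" "real i * s"] by simp
  have intd: "integrable lborel (\<lambda>x. (?d i x)\<^sup>2)" for i
    using integral_norm_shift_diff_le(2)[OF int[of s], of "real i * s"] by simp
  have "(LINT x|lborel. (v (x + real n * s) - v x)\<^sup>2) \<le> (LINT x|lborel. (\<Sum>i<n. (?d i x)\<^sup>2) * real n)"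
  proof (rule integral_mono[OF int])
    show "integrable lborel (\<lambda>x. (\<Sum>i<n. (?d i x)\<^sup>2) * real n)"
      by (intro integrable_mult_left Bochner_Integration.integrable_sum intd)
    fix x
    have "v (x + real n * s) - v x = (\<Sum>i<n. ?d i x)"
      using sum_lessThan_telescope[of "\<lambda>i. v (x + real i * s)" n] by (simp add: algebra_simps)
    then show "(v (x + real n * s) - v x)\<^sup>2 \<le> (\<Sum>i<n. (?d i x)\<^sup>2) * real n"
      using sum_squared_le_sum_of_squares[of "\<lambda>i. ?d i x" "{..<n}"] by simp
  qed
  also have "\<dots> = (\<Sum>i<n. LINT x|lborel. (?d i x)\<^sup>2) * real n"
    using intd by (simp add: Bochner_Integration.integral_sum)
  also have "\<dots> = (real n)\<^sup>2 * (LINT x|lborel. (v (x + s) - v x)\<^sup>2)"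
    unfolding shift by (simp add: power2_eq_square[of "real n"])
  finally show "(LINT x|lborel. (v (x + real n * s) - v x)\<^sup>2) \<le> (real n)\<^sup>2 * (LINT x|lborel. (v (x + s) - v x)\<^sup>2)" .
qed

section \<open>Representing the symbol through 1 - cos\<close>

lemma one_minus_cos_le: "1 - cos (x::real) \<le> x\<^sup>2 / 2"
proof -
  have "1 - cos x = 2 * (sin (x / 2))\<^sup>2" using cos_double_sin[of "x / 2"] by simp
  also have "(sin (x / 2))\<^sup>2 \<le> (x / 2)\<^sup>2"
    using abs_sin_x_le_abs_x[of "x / 2"] unfolding abs_le_square_iff .
  finally show ?thesis by (simp add: power_divide)
qed

text \<open>The half-angle formula with t = \<xi> / (2 (n + 1)) turns the expression into \<xi>^2
  (sinc t)^2, and \<open>sinc\<close> is continuous with value 1 at 0, which also treats \<xi> =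
  0.\<close>

lemma scaled_one_minus_cos_tendsto: "(\<lambda>n. 2 * (real (Suc n))\<^sup>2 * (1 - cos (\<xi> * (1 / real (Suc n))))) \<longlonglongrightarrow> \<xi>\<^sup>2"
proof -
  have eq: "2 * (real (Suc n))\<^sup>2 * (1 - cos (\<xi> * (1 / real (Suc n)))) = \<xi>\<^sup>2 * (sinc (\<xi> * (1 / real (Suc n)) / 2))\<^sup>2" for n
  proof -
    define t where "t = \<xi> * (1 / real (Suc n)) / 2"
    have t: "\<xi> * (1 / real (Suc n)) = 2 * t" "\<xi> = 2 * real (Suc n) * t"
      by (simp_all add: t_def del: of_nat_Suc)
    have "2 * (real (Suc n))\<^sup>2 * (1 - cos (2 * t)) = (2 * real (Suc n) * t)\<^sup>2 * (sinc t)\<^sup>2"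
      unfolding cos_double_sin by (simp add: power_mult_distrib power_divide del: of_nat_Suc)
    then show ?thesis unfolding t_def[symmetric] unfolding t(1) t(2)[symmetric] .
  qed
  have "(\<lambda>n. \<xi> * (1 / real (Suc n)) / 2) \<longlonglongrightarrow> 0"
    using tendsto_mult_right[OF LIMSEQ_inverse_real_of_nat, of "\<xi> / 2"] by (simp add: inverse_eq_divide mult.commute)
  then have "(\<lambda>n. sinc (\<xi> * (1 / real (Suc n)) / 2)) \<longlonglongrightarrow> sinc 0"
    by (rule isCont_tendsto_compose[OF isCont_sinc])
  then have "(\<lambda>n. \<xi>\<^sup>2 * (sinc (\<xi> * (1 / real (Suc n)) / 2))\<^sup>2) \<longlonglongrightarrow> \<xi>\<^sup>2 * (sinc 0)\<^sup>2"
    by (intro tendsto_intros)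
  then show ?thesis unfolding eq by simp
qed

definition cos_kernel :: "real \<Rightarrow> real \<Rightarrow> real \<Rightarrow> real" where
  "cos_kernel \<beta> \<xi> y = indicator {0<..} y * ((1 - cos (\<xi> * y)) * y powr (- 1 - \<beta>))"

lemma cos_kernel_nonneg: "cos_kernel \<beta> \<xi> y \<ge> 0"
  by (auto simp: cos_kernel_def indicator_def)

text \<open>Near 0 the bound 1 - cos y \<le> y^2 / 2 leaves y^(1-\<beta>), integrable because
  \<beta> < 2; away from 0 the factor is at most 2, and y^(-1-\<beta>) is integrable because \<beta>
  > 0.\<close>

lemma integrable_cos_kernel_1:
  assumes b: "0 < \<beta>" "\<beta> < 2"
  shows "integrable lborel (cos_kernel \<beta> 1)"
proof -
  have 1: "integrable lborel (\<lambda>y. indicator {0..1} y * y powr (1 - \<beta>))"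
  proof -
    have "((\<lambda>y. y powr (1 - \<beta>)) has_integral (1 powr (1 - \<beta> + 1) / (1 - \<beta> + 1))) {0..1}"
      by (rule has_integral_powr_from_0) (use b in auto)
    then have "(\<lambda>y. y powr (1 - \<beta>)) absolutely_integrable_on {0..1}"
      by (intro nonnegative_absolutely_integrable_1) auto
    then show ?thesis unfolding set_integrable_def by (subst (asm) integrable_completion) auto
  qed
  have 2: "integrable lborel (\<lambda>y. indicator {1..} y * y powr (- 1 - \<beta>))"
  proof -
    have "((\<lambda>y. y powr (- 1 - \<beta>)) has_integral (- (1 powr (- 1 - \<beta> + 1)) / (- 1 - \<beta> + 1))) {1..}"
      by (rule has_integral_powr_to_inf) (use b in auto)
    then have "(\<lambda>y. y powr (- 1 - \<beta>)) absolutely_integrable_on {1..}"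
      by (intro nonnegative_absolutely_integrable_1) auto
    then show ?thesis unfolding set_integrable_def by (subst (asm) integrable_completion) auto
  qed
  show ?thesis
  proof (rule Bochner_Integration.integrable_bound)
    show "integrable lborel (\<lambda>y. indicator {0..1} y * y powr (1 - \<beta>) + 2 * (indicator {1..} y * y powr (- 1 - \<beta>)))"
      using 1 2 by simp
    show "cos_kernel \<beta> 1 \<in> borel_measurable lborel" unfolding cos_kernel_def by measurable
    show "AE y in lborel. norm (cos_kernel \<beta> 1 y) \<le> norm (indicator {0..1} y * y powr (1 - \<beta>) + 2 * (indicator {1..} y * y powr (- 1 - \<beta>)))"
    proof (rule AE_I2)
      fix y :: real
      have "cos_kernel \<beta> 1 y \<le> indicator {0..1} y * y powr (1 - \<beta>) + 2 * (indicator {1..} y * y powr (- 1 - \<beta>))"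
      proof (cases "0 < y")
        case True
        show ?thesis
        proof (cases "y \<le> 1")
          case y1: True
          have "(1 - cos y) * y powr (- 1 - \<beta>) \<le> y\<^sup>2 / 2 * y powr (- 1 - \<beta>)"
            by (intro mult_right_mono one_minus_cos_le) auto
          also have "\<dots> = y powr (1 - \<beta>) / 2"
            using True powr_add[of y 2 "- 1 - \<beta>"] by (simp add: powr_numeral)
          also have "\<dots> \<le> y powr (1 - \<beta>)" by simp
          finally have "(1 - cos y) * y powr (- 1 - \<beta>) \<le> y powr (1 - \<beta>)" .
          \<comment> \<open>At y = 1 both parts of the majorant are present, and the comparison
            reduces to this numerical fact.\<close>
          moreover have "- cos 1 \<le> (2::real)" using cos_ge_minus_one[of 1] by linarith
          ultimately show ?thesis using True y1 by (simp add: cos_kernel_def indicator_def)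
        next
          case False
          have "(1 - cos y) * y powr (- 1 - \<beta>) \<le> 2 * y powr (- 1 - \<beta>)"
            using cos_ge_minus_one[of y] by (intro mult_right_mono) auto
          then show ?thesis using True False by (simp add: cos_kernel_def indicator_def)
        qed
      qed (auto simp: cos_kernel_def indicator_def)
      then show "norm (cos_kernel \<beta> 1 y) \<le> norm (indicator {0..1} y * y powr (1 - \<beta>) + 2 * (indicator {1..} y * y powr (- 1 - \<beta>)))"
        unfolding real_norm_def abs_of_nonneg[OF cos_kernel_nonneg] by linarith
    qed
  qed
qed

text \<open>Replacing y by |\<xi>| y turns the kernel at frequency 1 into the one at \<xi>, with
  total factor |\<xi>| |\<xi>|^(-1-\<beta>) = |\<xi>|^(-\<beta>). At \<xi> = 0 both sides vanish, as
  \<open>0 powr \<beta> = 0\<close>.\<close>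

lemma integral_cos_kernel:
  assumes b: "0 < \<beta>" "\<beta> < 2"
  shows "integrable lborel (cos_kernel \<beta> \<xi>)"
    and "(LINT y|lborel. cos_kernel \<beta> \<xi> y) = \<bar>\<xi>\<bar> powr \<beta> * (LINT y|lborel. cos_kernel \<beta> 1 y)"
proof -
  have "integrable lborel (cos_kernel \<beta> \<xi>) \<and>
    (LINT y|lborel. cos_kernel \<beta> \<xi> y) = \<bar>\<xi>\<bar> powr \<beta> * (LINT y|lborel. cos_kernel \<beta> 1 y)"
  proof (cases "\<xi> = 0")
    case True
    then have "cos_kernel \<beta> \<xi> = (\<lambda>y. 0)" by (auto simp: cos_kernel_def)
    with True b show ?thesis by simp
  next
    case False
    have eq: "cos_kernel \<beta> 1 (0 + \<bar>\<xi>\<bar> * y) = \<bar>\<xi>\<bar> powr (- 1 - \<beta>) * cos_kernel \<beta> \<xi> y" for y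
    proof -
      have "cos (\<bar>\<xi>\<bar> * y) = cos (\<xi> * y)" by (cases "\<xi> \<ge> 0") auto
      moreover have "(\<bar>\<xi>\<bar> * y) powr (- 1 - \<beta>) = \<bar>\<xi>\<bar> powr (- 1 - \<beta>) * y powr (- 1 - \<beta>)" if "y > 0"
        using that by (simp add: powr_mult)
      ultimately show ?thesis
        using False by (auto simp: cos_kernel_def indicator_def zero_less_mult_iff)
    qed
    have "integrable lborel (\<lambda>y. \<bar>\<xi>\<bar> powr (- 1 - \<beta>) * cos_kernel \<beta> \<xi> y)"
      using lborel_integrable_real_affine[OF integrable_cos_kernel_1[OF b], of "\<bar>\<xi>\<bar>" 0] False unfolding eq by simp
    then have i: "integrable lborel (cos_kernel \<beta> \<xi>)" using False by simp
    have "(LINT y|lborel. cos_kernel \<beta> 1 y) = \<bar>\<xi>\<bar> * (\<bar>\<xi>\<bar> powr (- 1 - \<beta>) * (LINT y|lborel. cos_kernel \<beta> \<xi> y))"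
      using lborel_integral_real_affine[of "\<bar>\<xi>\<bar>" "cos_kernel \<beta> 1" 0] False unfolding eq by simp
    also have "\<dots> = \<bar>\<xi>\<bar> powr (- \<beta>) * (LINT y|lborel. cos_kernel \<beta> \<xi> y)"
      using False powr_add[of "\<bar>\<xi>\<bar>" 1 "- 1 - \<beta>"] by simp
    finally show ?thesis using i False by (simp add: powr_minus)
  qed
  then show "integrable lborel (cos_kernel \<beta> \<xi>)"
    "(LINT y|lborel. cos_kernel \<beta> \<xi> y) = \<bar>\<xi>\<bar> powr \<beta> * (LINT y|lborel. cos_kernel \<beta> 1 y)" by auto
qed

section \<open>Positivity\<close>

text \<open>Here \<open>k = 2 * m\<close>, and the bound \<open>M\<close> is the one provided by
  \<open>AE_bounded_if_integrable_fourier\<close>.\<close>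

locale power_pairing =
  fixes u :: "real \<Rightarrow> real" and M :: real and m :: nat
  assumes U: "(\<lambda>x. complex_of_real (u x)) \<in> sobolev 2"
    and M: "M \<ge> 0" "AE x in lborel. \<bar>u x\<bar> \<le> M"
    and m: "m > 0"
    and nonzero: "\<not> (AE x in lborel. u x = 0)"
begin

definition f :: "real \<Rightarrow> complex" where "f x = of_real (u x ^ (2 * m + 1))"

definition fourier_pairing :: "real \<Rightarrow> complex" where
  "fourier_pairing \<xi> = fourier (\<lambda>x. of_real (u x)) \<xi> * FT f (- \<xi>)"

text \<open>This is Q(y) of the overview.\<close>

definition increment :: "real \<Rightarrow> real" where
  "increment y = (LINT x|lborel. (u (x + y) ^ (2 * m + 1) - u x ^ (2 * m + 1)) * (u (x + y) - u x))"

text \<open>This is P(y) of the overview; the exponent m + 1 is k/2 + 1.\<close>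

definition power_increment :: "real \<Rightarrow> real" where
  "power_increment y = (LINT x|lborel. (u (x + y) ^ (m + 1) - u x ^ (m + 1))\<^sup>2)"

lemma U_L2: "(\<lambda>x. complex_of_real (u x)) \<in> L2"
  using sobolev_2D(1)[OF U] .

lemma u_measurable [measurable]: "u \<in> borel_measurable borel"
proof -
  have "(\<lambda>x. Re (complex_of_real (u x))) \<in> borel_measurable borel" using U_L2 by measurable
  then show ?thesis by simp
qed

lemma u_square_integrable: "integrable lborel (\<lambda>x. (u x)\<^sup>2)"
  using L2_integrable[OF U_L2] by simp

lemma f_measurable [measurable]: "f \<in> borel_measurable borel"
  unfolding f_def by measurable

lemma f_bounded: "AE x in lborel. cmod (f x) \<le> M ^ (2 * m + 1)"
  using M(2) unfolding f_def norm_of_real power_abs by eventually_elim (intro power_mono, auto)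

lemma f_L2: "f \<in> L2"
proof (rule L2_bound[OF U_L2])
  show "AE x in lborel. cmod (f x) \<le> M ^ (2 * m) * cmod (of_real (u x))"
    using M(2) unfolding f_def norm_of_real power_add power_one_right abs_mult power_abs
    by eventually_elim (intro mult_right_mono power_mono, auto)
qed measurable

text \<open>Of the 2 m + 1 factors two form the integrable u^2, and the other 2 m - 1 are each
  bounded by \<open>M\<close>; this split requires m > 0.\<close>

lemma f_integrable: "integrable lborel f"
proof (rule Bochner_Integration.integrable_bound)
  show "integrable lborel (\<lambda>x. M ^ (2 * m - 1) * (u x)\<^sup>2)" using u_square_integrable by simp
  show "AE x in lborel. norm (f x) \<le> norm (M ^ (2 * m - 1) * (u x)\<^sup>2)"
    using M(2)
  proof eventually_elim
    case (elim x)
    have "norm (f x) = \<bar>u x\<bar> ^ (2 * m - 1) * (u x)\<^sup>2"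
      unfolding f_def norm_of_real power_abs power2_abs[of "u x", symmetric] power_add[symmetric] using m by simp
    also have "\<dots> \<le> M ^ (2 * m - 1) * (u x)\<^sup>2" using elim by (intro mult_right_mono power_mono) auto
    finally show ?case by simp
  qed
qed measurable

lemma power_square_integrable: "integrable lborel (\<lambda>x. (u x ^ (m + 1))\<^sup>2)"
proof (rule Bochner_Integration.integrable_bound)
  show "integrable lborel (\<lambda>x. (M ^ m)\<^sup>2 * (u x)\<^sup>2)" using u_square_integrable by simp
  show "AE x in lborel. norm ((u x ^ (m + 1))\<^sup>2) \<le> norm ((M ^ m)\<^sup>2 * (u x)\<^sup>2)"
    using M(2)
  proof eventually_elim
    case (elim x)
    have "(u x ^ (m + 1))\<^sup>2 = (\<bar>u x\<bar> ^ m)\<^sup>2 * (u x)\<^sup>2"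
      by (simp add: power_mult_distrib power_abs[symmetric])
    also have "\<dots> \<le> (M ^ m)\<^sup>2 * (u x)\<^sup>2" using elim by (intro mult_right_mono power_mono) auto
    finally show ?case by simp
  qed
qed measurable

text \<open>Apart from the value, this shows that the pairing against 1 - cos is real, which is the
  source of the vanishing imaginary parts below.\<close>

lemma fourier_pairing_increment:
  "(LINT \<xi>|lborel. fourier_pairing \<xi> * of_real (1 - cos (\<xi> * y))) = of_real (pi * increment y)"
proof -
  have "(LINT \<xi>|lborel. fourier_pairing \<xi> * of_real (1 - cos (\<xi> * y)))
    = pi * (LINT x|lborel. (f (x + y) - f x) * (complex_of_real (u (x + y)) - complex_of_real (u x)))"
    unfolding fourier_pairing_def by (rule fourier_increment[OF U_L2 f_integrable f_L2 f_bounded])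
  also have "(LINT x|lborel. (f (x + y) - f x) * (complex_of_real (u (x + y)) - complex_of_real (u x)))
    = of_real (increment y)"
    unfolding increment_def integral_complex_of_real[symmetric] f_def by (simp only: of_real_diff of_real_mult)
  finally show ?thesis by simp
qed

lemma power_increment_le: "power_increment y \<le> 2 * (real m + 1)\<^sup>2 * increment y"
proof -
  have i: "integrable lborel (\<lambda>x. (u (x + y) ^ (2 * m + 1) - u x ^ (2 * m + 1)) * (u (x + y) - u x))"
  proof -
    have "integrable lborel (\<lambda>x. (f (x + y) - f x) * (complex_of_real (u (x + y)) - complex_of_real (u x)))"
      by (intro integrable_L2_mult L2_diff f_L2 U_L2 L2_shift[OF f_L2] L2_shift[OF U_L2])
    from integrable_Re[OF this] show ?thesis
      unfolding f_def of_real_diff[symmetric] of_real_mult[symmetric] Re_complex_of_real .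
  qed
  have "power_increment y \<le> (LINT x|lborel. 2 * (real m + 1)\<^sup>2 * ((u (x + y) ^ (2 * m + 1) - u x ^ (2 * m + 1)) * (u (x + y) - u x)))"
    unfolding power_increment_def
  proof (rule integral_mono)
    show "integrable lborel (\<lambda>x. (u (x + y) ^ (m + 1) - u x ^ (m + 1))\<^sup>2)"
      by (rule integral_increment_le(1)[OF _ power_square_integrable]) measurable
    show "integrable lborel (\<lambda>x. 2 * (real m + 1)\<^sup>2 * ((u (x + y) ^ (2 * m + 1) - u x ^ (2 * m + 1)) * (u (x + y) - u x)))"
      using i by (rule integrable_mult_right)
  qed (rule square_power_diff_le)
  also have "\<dots> = 2 * (real m + 1)\<^sup>2 * increment y" unfolding increment_def by (rule integral_mult_right_zero)
  finally show ?thesis .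
qed

lemma power_increment_scale: "power_increment (real n * s) \<le> (real n)\<^sup>2 * power_increment s"
  unfolding power_increment_def by (rule integral_increment_le(2)[OF _ power_square_integrable]) measurable

text \<open>If P(y) were 0, then u^(m+1) would be square-integrable and periodic with period
  \<open>y\<close>, hence zero almost everywhere.\<close>

lemma power_increment_pos:
  assumes "y > 0"
  shows "power_increment y > 0"
proof -
  let ?v = "\<lambda>x. u x ^ (m + 1)"
  have i: "integrable lborel (\<lambda>x. (?v (x + y) - ?v x)\<^sup>2)"
    by (rule integral_increment_le(1)[OF _ power_square_integrable]) measurable
  have "power_increment y \<noteq> 0"
  proof
    assume "power_increment y = 0"
    then have "AE x in lborel. (?v (x + y) - ?v x)\<^sup>2 = 0"
      unfolding power_increment_def by (subst (asm) integral_nonneg_eq_0_iff_AE[OF i]) auto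
    then have "AE x in lborel. ?v (x + y) = ?v x" by eventually_elim simp
    then have "AE x in lborel. u x ^ (m + 1) = 0"
      by (intro L2_periodic_zero[OF _ power_square_integrable assms]) measurable
    then have "AE x in lborel. u x = 0" by eventually_elim auto
    with nonzero show False by simp
  qed
  moreover have "power_increment y \<ge> 0" by (simp add: power_increment_def)
  ultimately show ?thesis by simp
qed

text \<open>Strictness is inherited from P through the comparison, so the periodicity argument is
  made once, for u^(m+1).\<close>

lemma increment_pos: "y > 0 \<Longrightarrow> increment y > 0"
  using order.strict_trans2[OF power_increment_pos power_increment_le[of y]]
  by (auto simp: zero_less_mult_iff)

text \<open>The transform of \<open>u\<close> takes all of the weight, which H^2 regularity allows
  up to \<beta> = 2; the other factor is in \<open>L2\<close>.\<close>

lemma integrable_weighted_pairing: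
  assumes "0 \<le> \<beta>" "\<beta> \<le> 2"
  shows "integrable lborel (\<lambda>\<xi>. of_real (\<bar>\<xi>\<bar> powr \<beta>) * fourier_pairing \<xi>)"
  using integrable_L2_mult[OF sobolev_2D(3)[OF U assms] L2_reflect[OF FT_in_L2[OF f_integrable f_L2]]]
  unfolding fourier_pairing_def mult.assoc .

lemma fourier_pairing_measurable [measurable]: "fourier_pairing \<in> borel_measurable borel"
proof -
  have [measurable]: "fourier (\<lambda>x. of_real (u x)) \<in> borel_measurable borel"
    using fourier_spec(1)[OF U_L2] by auto
  show ?thesis unfolding fourier_pairing_def by measurable
qed

text \<open>Each approximating integral is 2 (n + 1)^2 pi Q(1 / (n + 1)) and so positive, but
  strictness could be lost in the limit; the constant \<open>c\<close> is a positive lower bound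
  independent of \<open>n\<close>.\<close>

lemma pairing_pos_2: "(LINT \<xi>|lborel. of_real (\<bar>\<xi>\<bar> powr 2) * fourier_pairing \<xi>) > 0"
proof -
  let ?J = "LINT \<xi>|lborel. of_real (\<bar>\<xi>\<bar> powr 2) * fourier_pairing \<xi>"
  define w where "w n \<xi> = 2 * (real (Suc n))\<^sup>2 * (1 - cos (\<xi> * (1 / real (Suc n))))" for n \<xi>
  have sq: "\<bar>\<xi>\<bar> powr 2 = \<xi>\<^sup>2" for \<xi> :: real by (cases "\<xi> = 0") (auto simp: powr_numeral)
  have w0: "w n \<xi> \<ge> 0" for n \<xi> by (simp add: w_def)
  have wle: "w n \<xi> \<le> \<xi>\<^sup>2" for n \<xi>
  proof -
    have "w n \<xi> \<le> 2 * (real (Suc n))\<^sup>2 * ((\<xi> * (1 / real (Suc n)))\<^sup>2 / 2)"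
      unfolding w_def by (intro mult_left_mono one_minus_cos_le) auto
    also have "\<dots> = \<xi>\<^sup>2" by (simp add: power_mult_distrib power_divide del: of_nat_Suc)
    finally show ?thesis .
  qed
  have lim: "(\<lambda>n. LINT \<xi>|lborel. of_real (w n \<xi>) * fourier_pairing \<xi>) \<longlonglongrightarrow> ?J"
  proof (rule integral_dominated_convergence)
    show "integrable lborel (\<lambda>\<xi>. norm (of_real (\<bar>\<xi>\<bar> powr 2) * fourier_pairing \<xi>))"
      by (intro integrable_norm integrable_weighted_pairing) auto
    show "AE \<xi> in lborel. (\<lambda>n. of_real (w n \<xi>) * fourier_pairing \<xi>) \<longlonglongrightarrow> of_real (\<bar>\<xi>\<bar> powr 2) * fourier_pairing \<xi>"
      unfolding sq w_def by (intro AE_I2 tendsto_mult tendsto_const tendsto_of_real scaled_one_minus_cos_tendsto)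
    show "AE \<xi> in lborel. norm (of_real (w n \<xi>) * fourier_pairing \<xi>) \<le> norm (of_real (\<bar>\<xi>\<bar> powr 2) * fourier_pairing \<xi>)" for n
      unfolding sq norm_mult norm_of_real
      by (intro AE_I2 mult_right_mono) (use w0 wle in \<open>auto simp: abs_of_nonneg\<close>)
    show "(\<lambda>\<xi>. of_real (w n \<xi>) * fourier_pairing \<xi>) \<in> borel_measurable lborel" for n
      unfolding w_def by measurable
  qed measurable
  have eq: "(LINT \<xi>|lborel. of_real (w n \<xi>) * fourier_pairing \<xi>) = of_real (2 * (real (Suc n))\<^sup>2 * (pi * increment (1 / real (Suc n))))" for n
  proof -
    have "(LINT \<xi>|lborel. of_real (w n \<xi>) * fourier_pairing \<xi>)
      = (LINT \<xi>|lborel. of_real (2 * (real (Suc n))\<^sup>2) * (fourier_pairing \<xi> * of_real (1 - cos (\<xi> * (1 / real (Suc n))))))"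
      unfolding w_def of_real_mult by (simp only: mult_ac)
    also have "\<dots> = of_real (2 * (real (Suc n))\<^sup>2) * (LINT \<xi>|lborel. fourier_pairing \<xi> * of_real (1 - cos (\<xi> * (1 / real (Suc n)))))"
      by (rule integral_mult_right_zero)
    finally show ?thesis unfolding fourier_pairing_increment of_real_mult[symmetric] .
  qed
  note lim = lim[unfolded eq]
  \<comment> \<open>With N = n + 1, P(1) \<le> N^2 P(1/N) \<le> 2 (m + 1)^2 N^2 Q(1/N). Multiplying
    by pi and dividing by (m + 1)^2 gives the lower bound.\<close>
  define c where "c = pi * power_increment 1 / (real m + 1)\<^sup>2"
  have "c > 0" unfolding c_def by (intro divide_pos_pos mult_pos_pos power_increment_pos) auto
  have "c \<le> 2 * (real (Suc n))\<^sup>2 * (pi * increment (1 / real (Suc n)))" for n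
  proof -
    have "power_increment 1 \<le> (real (Suc n))\<^sup>2 * power_increment (1 / real (Suc n))"
      using power_increment_scale[of "Suc n" "1 / real (Suc n)"] by simp
    also have "\<dots> \<le> (real (Suc n))\<^sup>2 * (2 * (real m + 1)\<^sup>2 * increment (1 / real (Suc n)))"
      by (intro mult_left_mono power_increment_le) auto
    finally have "pi * power_increment 1 \<le> pi * ((real (Suc n))\<^sup>2 * (2 * (real m + 1)\<^sup>2 * increment (1 / real (Suc n))))"
      by (intro mult_left_mono) auto
    then show ?thesis unfolding c_def by (subst pos_divide_le_eq) (auto simp: mult_ac)
  qed
  then have "c \<le> Re ?J"
    by (intro LIMSEQ_le_const[OF tendsto_Re[OF lim]]) (auto simp del: of_nat_Suc)
  \<comment> \<open>All approximating values are real.\<close>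
  moreover have "Im ?J = 0"
    using LIMSEQ_unique[OF tendsto_Im[OF lim], of 0] by simp
  ultimately show ?thesis using \<open>c > 0\<close> by (simp add: less_complex_def)
qed

text \<open>Integrating kernel times pairing in y gives C |\<xi>|^\<beta> times the pairing;
  integrating it in \<xi> gives pi y^(-1-\<beta>) Q(y) for y > 0. Fubini equates the two iterated
  integrals.\<close>

lemma pairing_pos_less_2:
  assumes b: "0 < \<beta>" "\<beta> < 2"
  shows "(LINT \<xi>|lborel. of_real (\<bar>\<xi>\<bar> powr \<beta>) * fourier_pairing \<xi>) > 0"
proof -
  let ?J = "LINT \<xi>|lborel. of_real (\<bar>\<xi>\<bar> powr \<beta>) * fourier_pairing \<xi>"
  let ?K = "\<lambda>\<xi> y. complex_of_real (cos_kernel \<beta> \<xi> y) * fourier_pairing \<xi>"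
  let ?w = "\<lambda>y::real. indicator {0<..} y * y powr (- 1 - \<beta>)"
  define C where "C = (LINT y|lborel. cos_kernel \<beta> 1 y)"
  have C0: "C \<ge> 0" unfolding C_def by (intro integral_nonneg_AE AE_I2 cos_kernel_nonneg)
  have inner: "(LINT y|lborel. ?K \<xi> y) = of_real C * (of_real (\<bar>\<xi>\<bar> powr \<beta>) * fourier_pairing \<xi>)" for \<xi>
  proof -
    have "(LINT y|lborel. ?K \<xi> y) = of_real (LINT y|lborel. cos_kernel \<beta> \<xi> y) * fourier_pairing \<xi>"
      by simp
    then show ?thesis unfolding integral_cos_kernel(2)[OF b, of \<xi>] C_def[symmetric] by (simp only: of_real_mult mult_ac)
  qed
  \<comment> \<open>Since the kernel is nonnegative, the same computation yields the absolute
    integral that Fubini requires.\<close>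
  have inner': "(LINT y|lborel. norm (?K \<xi> y)) = C * norm (of_real (\<bar>\<xi>\<bar> powr \<beta>) * fourier_pairing \<xi>)" for \<xi>
  proof -
    have "(LINT y|lborel. norm (?K \<xi> y)) = (LINT y|lborel. cos_kernel \<beta> \<xi> y * norm (fourier_pairing \<xi>))"
      unfolding norm_mult norm_of_real abs_of_nonneg[OF cos_kernel_nonneg] ..
    also have "\<dots> = (LINT y|lborel. cos_kernel \<beta> \<xi> y) * norm (fourier_pairing \<xi>)" by simp
    finally show ?thesis unfolding integral_cos_kernel(2)[OF b, of \<xi>] C_def[symmetric] by (simp add: norm_mult mult_ac)
  qed
  have outer: "(LINT \<xi>|lborel. ?K \<xi> y) = of_real (pi * (?w y * increment y))" for y
  proof -
    have "(LINT \<xi>|lborel. ?K \<xi> y) = (LINT \<xi>|lborel. of_real (?w y) * (fourier_pairing \<xi> * of_real (1 - cos (\<xi> * y))))"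
      unfolding cos_kernel_def of_real_mult by (simp only: mult_ac)
    also have "\<dots> = of_real (?w y) * (LINT \<xi>|lborel. fourier_pairing \<xi> * of_real (1 - cos (\<xi> * y)))"
      by (rule integral_mult_right_zero)
    finally show ?thesis unfolding fourier_pairing_increment by (simp add: mult_ac)
  qed
  have K: "integrable (lborel \<Otimes>\<^sub>M lborel) (\<lambda>(\<xi>, y). ?K \<xi> y)"
  proof (rule lborel_pair.Fubini_integrable)
    show "(\<lambda>(\<xi>, y). ?K \<xi> y) \<in> borel_measurable (lborel \<Otimes>\<^sub>M lborel)"
      unfolding cos_kernel_def by measurable
    show "integrable lborel (\<lambda>\<xi>. LINT y|lborel. norm (case (\<xi>, y) of (\<xi>, y) \<Rightarrow> ?K \<xi> y))"
      unfolding prod.case inner'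
      by (intro integrable_mult_right integrable_norm integrable_weighted_pairing) (use b in auto)
    show "AE \<xi> in lborel. integrable lborel (\<lambda>y. case (\<xi>, y) of (\<xi>, y) \<Rightarrow> ?K \<xi> y)"
      unfolding prod.case
      by (intro AE_I2 integrable_mult_left integrable_of_real integral_cos_kernel(1) b)
  qed
  have "of_real C * ?J = (LINT \<xi>|lborel. LINT y|lborel. ?K \<xi> y)"
    unfolding inner by (rule integral_mult_right_zero[symmetric])
  also have "\<dots> = (LINT y|lborel. LINT \<xi>|lborel. ?K \<xi> y)"
    using lborel_pair.Fubini_integral[OF K] by simp
  also have "\<dots> = of_real (LINT y|lborel. pi * (?w y * increment y))"
    unfolding outer by (rule integral_complex_of_real)
  finally have J: "of_real C * ?J = of_real (LINT y|lborel. pi * (?w y * increment y))" .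
  have iw: "integrable lborel (\<lambda>y. pi * (?w y * increment y))"
  proof -
    have "integrable lborel (\<lambda>y. LINT \<xi>|lborel. ?K \<xi> y)"
      using lborel_pair.integrable_snd[OF K] by simp
    from integrable_Re[OF this] show ?thesis unfolding outer Re_complex_of_real .
  qed
  have nn: "pi * (?w y * increment y) \<ge> 0" for y
    using increment_pos[of y] by (auto simp: indicator_def)
  have "(LINT y|lborel. pi * (?w y * increment y)) \<noteq> 0"
  proof
    assume "(LINT y|lborel. pi * (?w y * increment y)) = 0"
    then have "AE y in lborel. pi * (?w y * increment y) = 0"
      by (subst (asm) integral_nonneg_eq_0_iff_AE[OF iw]) (use nn in auto)
    \<comment> \<open>Q is positive on the whole half-line; the interval (0, 1), of measure 1,
      already excludes a vanishing integral.\<close>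
    then have "AE y in lborel. y \<notin> {0<..<1::real}"
    proof eventually_elim
      case (elim y)
      then show ?case using increment_pos[of y] by (auto simp: indicator_def)
    qed
    then have "emeasure lborel {0<..<1::real} = 0"
      using AE_iff_null_sets[of "{0<..<1::real}" lborel] by auto
    then show False by simp
  qed
  moreover have "(LINT y|lborel. pi * (?w y * increment y)) \<ge> 0"
    by (rule integral_nonneg_AE, rule AE_I2, rule nn)
  ultimately have I: "(LINT y|lborel. pi * (?w y * increment y)) > 0" by linarith
  \<comment> \<open>Positivity of \<open>C\<close> is read off the identity \<open>J\<close> itself:
    with C = 0 its left side would vanish.\<close>
  then have "C \<noteq> 0" using J by auto
  with C0 have "C > 0" by simp
  have "?J = of_real ((LINT y|lborel. pi * (?w y * increment y)) / C)"
    using J \<open>C > 0\<close> by (simp add: field_simps)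
  also have "\<dots> > 0" using I \<open>C > 0\<close> by (simp add: less_complex_def)
  finally show ?thesis .
qed

lemma integral_mult_frac_deriv:
  assumes "0 \<le> \<beta>" "\<beta> \<le> 2"
  shows "(LINT x|lborel. f x * frac_deriv \<beta> (\<lambda>x. complex_of_real (u x)) x)
    = of_real (1 / (2 * pi)) * (LINT \<xi>|lborel. of_real (\<bar>\<xi>\<bar> powr \<beta>) * fourier_pairing \<xi>)"
  unfolding frac_deriv_def integral_mult_inv_fourier[OF f_integrable f_L2 sobolev_2D(3)[OF U assms]]
  unfolding fourier_pairing_def mult.assoc by simp

end

theorem corollary5p4:
  fixes \<beta> :: real and u :: "real \<Rightarrow> real" and k :: nat
  assumes "1 < \<beta>" and "\<beta> \<le> 2"
    and "(\<lambda>x. complex_of_real (u x)) \<in> sobolev 2"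
    and "\<not> (AE x in lborel. u x = 0)"
    and "even k" and "k > 0"
  shows "(LINT x|lborel.
           complex_of_real (u x ^ (k + 1)) * frac_deriv \<beta> (\<lambda>x. complex_of_real (u x)) x) > 0"
proof -
  obtain m where k: "k = 2 * m" and m: "m > 0" using assms(5,6) by (auto elim!: evenE)
  obtain M where "M \<ge> 0" "AE x in lborel. \<bar>u x\<bar> \<le> M"
    using AE_bounded_if_integrable_fourier[OF sobolev_2D(1,2)[OF assms(3)]] .
  then interpret power_pairing u M m
    using assms(3,4) m by unfold_locales
  have J: "(LINT \<xi>|lborel. of_real (\<bar>\<xi>\<bar> powr \<beta>) * fourier_pairing \<xi>) > 0"
    using pairing_pos_2 pairing_pos_less_2[of \<beta>] assms(1,2) by (cases "\<beta> = 2") auto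
  have "(LINT x|lborel. f x * frac_deriv \<beta> (\<lambda>x. complex_of_real (u x)) x) > 0"
    using J assms(1,2) unfolding integral_mult_frac_deriv[of \<beta>]
    by (subst integral_mult_frac_deriv) (auto simp: less_complex_def)
  then show ?thesis unfolding f_def k .
qed

end
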